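(* Let $T>0$, $d>0$, $c\in(\tfrac12,1)$ and $\epsilon\in(0,\tfrac12)$. Consider the zero-sum game in which the detector chooses a test $\phi$ with $\alpha(\phi)\le\epsilon$ so as to minimize $\beta(\theta,\phi)$, and the attacker chooses an attack signal $\theta$ with $\gamma(\theta)\ge c$ so as to maximize $\beta(\theta,\phi)$ (all objects as defined in the context). Define $$\theta^*(t)=\bar\theta:=\frac{1}{\sqrt T}\Phi^{-1}(c)+d\quad\forall t\in[0,T],\qquad \phi^*(x)=\begin{cases}0 & \text{if } x(T)\le \sqrt T\,\Phi^{-1}(1-\epsilon),\\ 1 & \text{if } x(T)>\sqrt T\,\Phi^{-1}(1-\epsilon).\end{cases}$$ Then: (i) $(\theta^*,\phi^* )$ is a saddle point of the game, i.e. $\gamma(\theta^* )\ge c$, $\alpha(\phi^* )\le\epsilon$, and $\beta(\theta,\phi^* )\le\beta(\theta^*,\phi^* )\le\beta(\theta^*,\phi)$ for all $\phi$ with $\alpha(\phi)\le\epsilon$ and all $\theta$ with $\gamma(\theta)\ge c$. (ii) The saddle point is unique in the following sense: if $(\theta',\phi')$ is another saddle point, then $\theta^*(t)=\theta'(t)$ for almost every $t\in[0,T]$, and $\phi^*(x)=\phi'(x)$ $\mu$-almost surely. (iii) The value of the game (the common value $p^*=d^*$) is $$\beta(\theta^*,\phi^* )=\Phi\big(\Phi^{-1}(1-\epsilon)-\Phi^{-1}(c)-\sqrt T\,d\big).$$ In particular, if $1-\epsilon=c$, then $\beta(\theta^*,\phi^* )=\Phi(-\sqrt T\,d)$.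
   Context: $\Phi(x)=\frac{1}{\sqrt{2\pi}}\int_{-\infty}^x e^{-t^2/2}\,dt$ is the standard normal cumulative distribution function. Let $w(t)$, $0\le t\le T$, be a standard one-dimensional Brownian motion on a probability space $(\Omega,\mathcal F,\mu)$. An attack signal is a deterministic (open-loop, non-randomized) Borel measurable function $\theta:[0,T]\to\mathbb R$ with $\int_0^T|\theta(t)|\,dt<\infty$. Given $\theta$, the observed trajectory $x$ is the process defined by $dx(t)=\theta(t)\,dt+dw(t)$, $x(0)=0$, i.e. $x(t)=\int_0^t\theta(s)\,ds+w(t)$. The attack success rate is $\gamma(\theta):=\Phi\big(\tfrac{m}{\sqrt T}-\sqrt T\,d\big)$ with $m=\int_0^T\theta(t)\,dt$; it equals the probability that $x(T)>Td$. The constraint $\gamma(\theta)\ge c$ is equivalent to $\int_0^T\theta(t)\,dt\ge\sqrt T\,\Phi^{-1}(c)+Td$. A test is a (measurable, non-randomized) map $\phi:C[0,T]\to\{0,1\}$, where $C[0,T]$ is the space of continuous functions $[0,T]\to\mathbb R$. Its false alarm (type I error) probability $\alpha(\phi)$ is the probability that $\phi(x)=1$ when $x$ is the trajectory with $\theta\equiv0$ (so $x$ is a standard Brownian motion). Its detection failure (type II error) probability $\beta(\theta,\phi)$ is the probability that $\phi(x)=0$ when $x$ is the trajectory generated with attack signal $\theta$. The minimax and maximin values are $p^*=\min_{\phi:\alpha(\phi)\le\epsilon}\max_{\theta:\gamma(\theta)\ge c}\beta(\theta,\phi)$ and $d^*=\max_{\theta:\gamma(\theta)\ge c}\min_{\phi:\alpha(\phi)\le\epsilon}\beta(\theta,\phi)$.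 A saddle point is a pair $(\theta^*,\phi^* )$ with $\gamma(\theta^* )\ge c$ and $\alpha(\phi^* )\le\epsilon$ satisfying $\beta(\theta,\phi^* )\le\beta(\theta^*,\phi^* )\le\beta(\theta^*,\phi)$ for all $\phi$ with $\alpha(\phi)\le\epsilon$ and all $\theta$ with $\gamma(\theta)\ge c$. In the uniqueness statement, "$\phi^*(x)=\phi'(x)$ $\mu$-almost surely" refers to the trajectory $x$ generated, under $\mu$, with attack signal $\theta^*$. *)

theory Defs
  imports "HOL-Probability.Probability"
begin

definition Phi :: "real \<Rightarrow> real" where
  "Phi x = 1 / sqrt (2 * pi) * (LBINT t:{..x}. exp (- t\<^sup>2 / 2))"

(* Only used on {0<..<1}, the range of the injective function Phi. *)
definition Phi_inv :: "real \<Rightarrow> real" where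
  "Phi_inv p = inv Phi p"

(* All paths, not just almost all, are continuous and start at 0, so that every trajectory is an
   element of C[0,T].  Values of w outside {0..T} are irrelevant. *)
locale std_brownian_motion = prob_space M
  for M :: "'a measure" and T :: real and w :: "real \<Rightarrow> 'a \<Rightarrow> real" +
  assumes measurable_w: "\<And>t. t \<in> {0..T} \<Longrightarrow> w t \<in> borel_measurable M"
    and w_0: "\<And>\<omega>. \<omega> \<in> space M \<Longrightarrow> w 0 \<omega> = 0"
    and continuous_paths: "\<And>\<omega>. \<omega> \<in> space M \<Longrightarrow> continuous_on {0..T} (\<lambda>t. w t \<omega>)"
    and normal_increments: "\<And>s t. 0 \<le> s \<Longrightarrow> s < t \<Longrightarrow> t \<le> T \<Longrightarrow>
      distributed M lborel (\<lambda>\<omega>. w t \<omega> - w s \<omega>) (normal_density 0 (sqrt (t - s)))"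
    and indep_increments: "\<And>(n::nat) \<tau>. mono_on {0..n} \<tau> \<Longrightarrow> \<tau> ` {0..n} \<subseteq> {0..T} \<Longrightarrow>
      indep_vars (\<lambda>_. borel) (\<lambda>i \<omega>. w (\<tau> (Suc i)) \<omega> - w (\<tau> i) \<omega>) {..<n}"

(* C[0,T] with the sigma-algebra generated by the evaluations, which is the Borel sigma-algebra of
   the supremum norm.  Paths are extensional: undefined outside {0..T}. *)
definition path_space :: "real \<Rightarrow> (real \<Rightarrow> real) measure" where
  "path_space T = restrict_space (\<Pi>\<^sub>M t\<in>{0..T}. borel) {x. continuous_on {0..T} x}"

(* Integrability includes Borel measurability of the restriction to {0..T};
   values of the signal outside {0..T} are unconstrained and never used. *)
definition attack_signal :: "real \<Rightarrow> (real \<Rightarrow> real) \<Rightarrow> bool" where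
  "attack_signal T \<theta> \<longleftrightarrow> set_integrable lborel {0..T} \<theta>"

definition trajectory ::
    "real \<Rightarrow> (real \<Rightarrow> 'a \<Rightarrow> real) \<Rightarrow> (real \<Rightarrow> real) \<Rightarrow> 'a \<Rightarrow> (real \<Rightarrow> real)" where
  "trajectory T w \<theta> \<omega> = (\<lambda>t\<in>{0..T}. (LBINT s:{0..t}. \<theta> s) + w t \<omega>)"

definition success_rate :: "real \<Rightarrow> real \<Rightarrow> (real \<Rightarrow> real) \<Rightarrow> real" where
  "success_rate T d \<theta> = Phi ((LBINT t:{0..T}. \<theta> t) / sqrt T - sqrt T * d)"

definition is_test :: "real \<Rightarrow> ((real \<Rightarrow> real) \<Rightarrow> nat) \<Rightarrow> bool" where
  "is_test T \<phi> \<longleftrightarrow> \<phi> \<in> measurable (path_space T) (count_space {0, 1})"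

definition false_alarm ::
    "'a measure \<Rightarrow> real \<Rightarrow> (real \<Rightarrow> 'a \<Rightarrow> real) \<Rightarrow> ((real \<Rightarrow> real) \<Rightarrow> nat) \<Rightarrow> real" where
  "false_alarm M T w \<phi> = measure M {\<omega> \<in> space M. \<phi> (trajectory T w (\<lambda>_. 0) \<omega>) = 1}"

definition detection_failure ::
    "'a measure \<Rightarrow> real \<Rightarrow> (real \<Rightarrow> 'a \<Rightarrow> real) \<Rightarrow> (real \<Rightarrow> real) \<Rightarrow> ((real \<Rightarrow> real) \<Rightarrow> nat) \<Rightarrow> real"
  where
  "detection_failure M T w \<theta> \<phi> = measure M {\<omega> \<in> space M. \<phi> (trajectory T w \<theta> \<omega>) = 0}"

definition attacks :: "real \<Rightarrow> real \<Rightarrow> real \<Rightarrow> (real \<Rightarrow> real) set" where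
  "attacks T d c = {\<theta>. attack_signal T \<theta> \<and> success_rate T d \<theta> \<ge> c}"

definition tests ::
    "'a measure \<Rightarrow> real \<Rightarrow> (real \<Rightarrow> 'a \<Rightarrow> real) \<Rightarrow> real \<Rightarrow> ((real \<Rightarrow> real) \<Rightarrow> nat) set" where
  "tests M T w \<epsilon> = {\<phi>. is_test T \<phi> \<and> false_alarm M T w \<phi> \<le> \<epsilon>}"

definition saddle_point ::
    "'a measure \<Rightarrow> real \<Rightarrow> (real \<Rightarrow> 'a \<Rightarrow> real) \<Rightarrow> real \<Rightarrow> real \<Rightarrow> real \<Rightarrow>
     (real \<Rightarrow> real) \<Rightarrow> ((real \<Rightarrow> real) \<Rightarrow> nat) \<Rightarrow> bool" where
  "saddle_point M T w d c \<epsilon> \<theta>' \<phi>' \<longleftrightarrow>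
     \<theta>' \<in> attacks T d c \<and> \<phi>' \<in> tests M T w \<epsilon> \<and>
     (\<forall>\<theta> \<in> attacks T d c. detection_failure M T w \<theta> \<phi>' \<le> detection_failure M T w \<theta>' \<phi>') \<and>
     (\<forall>\<phi> \<in> tests M T w \<epsilon>. detection_failure M T w \<theta>' \<phi>' \<le> detection_failure M T w \<theta>' \<phi>)"

(* Infima and suprema rather than minima and maxima, since the inner optimum need not be attained
   for every strategy of the opponent.  At a saddle point all the optima involved are attained. *)
definition minimax_value ::
    "'a measure \<Rightarrow> real \<Rightarrow> (real \<Rightarrow> 'a \<Rightarrow> real) \<Rightarrow> real \<Rightarrow> real \<Rightarrow> real \<Rightarrow> real" where
  "minimax_value M T w d c \<epsilon> =
     (INF \<phi>\<in>tests M T w \<epsilon>. SUP \<theta>\<in>attacks T d c. detection_failure M T w \<theta> \<phi>)"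

definition maximin_value ::
    "'a measure \<Rightarrow> real \<Rightarrow> (real \<Rightarrow> 'a \<Rightarrow> real) \<Rightarrow> real \<Rightarrow> real \<Rightarrow> real \<Rightarrow> real" where
  "maximin_value M T w d c \<epsilon> =
     (SUP \<theta>\<in>attacks T d c. INF \<phi>\<in>tests M T w \<epsilon>. detection_failure M T w \<theta> \<phi>)"

definition theta_star :: "real \<Rightarrow> real \<Rightarrow> real \<Rightarrow> real \<Rightarrow> real" where
  "theta_star T d c = (\<lambda>t. 1 / sqrt T * Phi_inv c + d)"

definition phi_star :: "real \<Rightarrow> real \<Rightarrow> (real \<Rightarrow> real) \<Rightarrow> nat" where
  "phi_star T \<epsilon> = (\<lambda>x. if x T \<le> sqrt T * Phi_inv (1 - \<epsilon>) then 0 else 1)"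

end

theory Submission
  imports Defs
begin

text \<open>Under a constant drift \<open>a > 0\<close> the law of the trajectory has density
  \<open>exp (a w(T) - a\<^sup>2 T / 2)\<close> with respect to Brownian motion; this follows from independence and
  normality of finitely many increments, whose density is a product.  The density is increasing in
  the terminal value, so by the Neyman--Pearson lemma the threshold test on \<open>x(T)\<close> is optimal
  against \<open>a\<close>, uniquely up to null sets.  Against that test only the integral of the signal
  matters, which gives the saddle point and fixes the integral of the signal in any other one.
  A nonconstant signal with the same integral is ruled out without a Girsanov theorem for
  integrable drifts: against it a test with a suitable step-function weight, i.e. a threshold test
  on \<open>p x(t) + q (x(T) - x(t))\<close>, does strictly better than the one with constant weight.\<close>

section \<open>The standard normal distribution function\<close>

interpretation std_normal: real_distribution std_normal_distribution
  by (rule real_dist_normal_dist)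

lemma Phi_eq_cdf: "Phi x = cdf std_normal_distribution x"
proof -
  have "cdf std_normal_distribution x = (LINT t|std_normal_distribution. indicator {..x} t)"
    by (simp add: cdf_def)
  also have "\<dots> = (LBINT t. std_normal_density t * indicator {..x} t)"
    by (subst integral_density) (auto simp: normal_density_nonneg)
  also have "\<dots> = (LBINT t. 1 / sqrt (2 * pi) * (indicator {..x} t * exp (- t\<^sup>2 / 2)))"
    by (simp add: std_normal_density_def mult_ac)
  also have "\<dots> = Phi x"
    unfolding Phi_def set_lebesgue_integral_def by simp
  finally show ?thesis ..
qed

text \<open>The normal density vanishes nowhere. An interval of positive length therefore has
  positive normal mass, which makes \<open>Phi\<close> strictly increasing.\<close>

lemma null_sets_std_normal_imp_null:
  assumes "measure std_normal_distribution A = 0" and "A \<in> sets borel"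
  shows "A \<in> null_sets lborel"
proof -
  have "A \<in> null_sets std_normal_distribution"
    using assms by (auto simp: null_sets_def std_normal.emeasure_eq_measure)
  then have "AE x in lborel. x \<in> A \<longrightarrow> ennreal (std_normal_density x) = 0"
    by (subst (asm) null_sets_density_iff) auto
  moreover have "ennreal (std_normal_density x) \<noteq> 0" for x
    using normal_density_pos[of 1 0 x] by simp
  ultimately have "AE x in lborel. x \<notin> A"
    by simp
  then show ?thesis
    using assms(2) by (subst (asm) AE_iff_null_sets[symmetric]) auto
qed

lemma strict_mono_Phi: "strict_mono Phi"
proof (rule strict_monoI)
  fix x y :: real assume "x < y"
  have "measure std_normal_distribution {x<..y} \<noteq> 0"
  proof
    assume "measure std_normal_distribution {x<..y} = 0"
    then have "{x<..y} \<in> null_sets lborel"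
      by (rule null_sets_std_normal_imp_null) auto
    then show False
      using \<open>x < y\<close> by (auto simp: null_sets_def)
  qed
  then show "Phi x < Phi y"
    using std_normal.cdf_diff_eq[OF \<open>x < y\<close>] measure_nonneg[of std_normal_distribution "{x<..y}"]
    unfolding Phi_eq_cdf by linarith
qed

lemma Phi_less_iff [simp]: "Phi x < Phi y \<longleftrightarrow> x < y"
  by (rule strict_mono_less[OF strict_mono_Phi])

lemma Phi_le_iff [simp]: "Phi x \<le> Phi y \<longleftrightarrow> x \<le> y"
  by (rule strict_mono_less_eq[OF strict_mono_Phi])

lemma Phi_eq_iff [simp]: "Phi x = Phi y \<longleftrightarrow> x = y"
  by (rule strict_mono_eq[OF strict_mono_Phi])

lemma measure_std_normal_singleton: "measure std_normal_distribution {x} = 0"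
proof -
  have "AE y in lborel. y \<in> {x} \<longrightarrow> ennreal (std_normal_density y) = 0"
    using AE_lborel_singleton[of x] by (rule AE_mp) auto
  then have "{x} \<in> null_sets std_normal_distribution"
    by (subst null_sets_density_iff) auto
  then show ?thesis
    by (auto simp: null_sets_def measure_def)
qed

lemma isCont_Phi: "isCont Phi x"
proof -
  have "Phi = cdf std_normal_distribution"
    by (auto simp: Phi_eq_cdf)
  then show ?thesis
    using std_normal.isCont_cdf[of x] measure_std_normal_singleton[of x] by simp
qed

text \<open>\<open>Phi_inv\<close> is an inverse by choice, so only membership of \<open>p\<close>
  in the range of \<open>Phi\<close> is at stake. The limits 0 and 1 at the two ends and the
  intermediate value theorem give it.\<close>

lemma Phi_Phi_inv:
  assumes "0 < p" "p < 1"
  shows "Phi (Phi_inv p) = p"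
proof -
  have *: "Phi = cdf std_normal_distribution"
    by (auto simp: Phi_eq_cdf)
  have "eventually (\<lambda>x. Phi x < p) at_bot" "eventually (\<lambda>x. p < Phi x) at_top"
    unfolding * using order_tendstoD[OF std_normal.cdf_lim_at_bot]
      order_tendstoD[OF std_normal.cdf_lim_at_top_prob] assms by auto
  then obtain a b where "Phi a < p" "p < Phi b"
    by (auto simp: eventually_at_bot_linorder eventually_at_top_linorder)
  moreover from this have "a \<le> b"
    by (metis Phi_less_iff less_trans less_imp_le)
  ultimately have "\<exists>x. a \<le> x \<and> x \<le> b \<and> Phi x = p"
    by (intro IVT) (auto simp: isCont_Phi)
  then show ?thesis
    unfolding Phi_inv_def by (auto intro: f_inv_into_f)
qed

lemma (in prob_space) normal_prob_le:
  assumes "distributed M lborel X (normal_density \<mu> \<sigma>)" and "0 < \<sigma>"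
  shows "prob {\<omega> \<in> space M. X \<omega> \<le> k} = Phi ((k - \<mu>) / \<sigma>)"
proof -
  let ?Z = "\<lambda>\<omega>. (X \<omega> - \<mu>) / \<sigma>"
  have Z: "distributed M lborel ?Z std_normal_density"
    using assms normal_standard_normal_convert by blast
  have [measurable]: "?Z \<in> borel_measurable M"
    using distributed_measurable[OF Z] by simp
  have "Phi ((k - \<mu>) / \<sigma>) = measure (distr M lborel ?Z) {..(k - \<mu>) / \<sigma>}"
    unfolding Phi_eq_cdf cdf_def distributed_distr_eq_density[OF Z] ..
  also have "\<dots> = prob {\<omega> \<in> space M. ?Z \<omega> \<le> (k - \<mu>) / \<sigma>}"
    by (subst measure_distr) (auto intro!: arg_cong[where f = prob])
  also have "\<dots> = prob {\<omega> \<in> space M. X \<omega> \<le> k}"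
    using assms(2) by (simp add: divide_le_cancel)
  finally show ?thesis ..
qed

text \<open>Negation preserves the normal law, so the half-lines on both sides of 0 have equal mass.
  This is what later turns \<open>c > 1/2\<close> into positivity of
  \<open>Phi_inv c\<close>.\<close>

lemma Phi_zero: "Phi 0 = 1 / 2"
proof -
  let ?N = "std_normal_distribution"
  \<comment> \<open>On the probability space given by its own law, the identity is a standard normal
    variable; the affine rule then yields the law of \<open>- x\<close>.\<close>
  have id: "distributed ?N lborel (\<lambda>x. x) std_normal_density"
    unfolding distributed_def by (auto intro: distr_id2)
  have "distributed ?N lborel (\<lambda>x. 0 + (-1) * x) (normal_density (0 + (-1) * 0) (\<bar>-1\<bar> * 1))"
    by (rule std_normal.normal_density_affine[OF id]) auto
  then have "measure ?N {x \<in> space ?N. - x \<le> 0} = Phi 0"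
    using std_normal.normal_prob_le[of "\<lambda>x. - x" 0 1 0] by simp
  then have "measure ?N {0..} = Phi 0"
    by (simp add: atLeast_def)
  moreover have "measure ?N {0..} + measure ?N {..<0} = 1"
  proof -
    have "measure ?N ({0..} \<union> {..<0}) = measure ?N {0..} + measure ?N {..<0}"
      by (rule std_normal.finite_measure_Union) auto
    moreover have "{0..} \<union> {..<0} = (UNIV :: real set)"
      by auto
    ultimately show ?thesis
      using std_normal.prob_space by simp
  qed
  moreover have "measure ?N {..0} = measure ?N {..<0} + measure ?N {0}"
  proof -
    have "measure ?N ({..<0} \<union> {0}) = measure ?N {..<0} + measure ?N {0}"
      by (rule std_normal.finite_measure_Union) auto
    moreover have "{..<0} \<union> {0} = {..0::real}"
      by auto
    ultimately show ?thesis
      by simp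
  qed
  ultimately show ?thesis
    by (simp add: Phi_eq_cdf cdf_def measure_std_normal_singleton)
qed

section \<open>Functions with linear indefinite integral\<close>

text \<open>The positive and the negative part of \<open>f\<close> are densities of two measures
  that are finite and equal on all open half-lines. The measures then coincide, and uniqueness of
  densities makes the two parts equal almost everywhere.\<close>

lemma AE_zero_if_set_integral_greaterThan_zero:
  fixes f :: "real \<Rightarrow> real"
  assumes f: "integrable lborel f" and zero: "\<And>x. (LBINT t:{x<..}. f t) = 0"
  shows "AE t in lborel. f t = 0"
proof -
  have [measurable]: "f \<in> borel_measurable borel"
    using f by auto
  \<comment> \<open>\<open>ennreal\<close> sends negative reals to 0, so these are the positive and
    the negative part of \<open>f\<close>.\<close>
  let ?P = "\<lambda>t. ennreal (f t)" and ?N = "\<lambda>t. ennreal (- f t)"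
  have em: "emeasure (density lborel (\<lambda>t. ennreal (g t))) {x<..}
      = ennreal (LBINT t. max 0 (g t) * indicator {x<..} t)"
    if g: "integrable lborel g" for g :: "real \<Rightarrow> real" and x
  proof -
    have [measurable]: "g \<in> borel_measurable borel"
      using g by auto
    have int: "integrable lborel (\<lambda>t. max 0 (g t) * indicator {x<..} t)"
      by (rule integrable_real_mult_indicator) (auto intro: g)
    have "emeasure (density lborel (\<lambda>t. ennreal (g t))) {x<..}
        = (\<integral>\<^sup>+t. ennreal (g t) * indicator {x<..} t \<partial>lborel)"
      by (subst emeasure_density) auto
    also have "\<dots> = (\<integral>\<^sup>+t. ennreal (max 0 (g t) * indicator {x<..} t) \<partial>lborel)"
      by (intro nn_integral_cong) (auto simp: indicator_def max_def ennreal_neg)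
    also have "\<dots> = ennreal (LBINT t. max 0 (g t) * indicator {x<..} t)"
      using int by (intro nn_integral_eq_integral) auto
    finally show ?thesis .
  qed
  have f': "integrable lborel (\<lambda>t. - f t)"
    using f by simp
  have "density lborel ?P = density lborel ?N"
  proof (rule measure_eqI_lessThan)
    fix x
    show "emeasure (density lborel ?P) {x<..} < \<infinity>"
      using em[OF f] by simp
    have intP: "integrable lborel (\<lambda>t. max 0 (f t) * indicator {x<..} t)"
      by (rule integrable_real_mult_indicator) (auto intro: f)
    have intN: "integrable lborel (\<lambda>t. max 0 (- f t) * indicator {x<..} t)"
      by (rule integrable_real_mult_indicator) (auto intro: f')
    have "(LBINT t. max 0 (f t) * indicator {x<..} t) - (LBINT t. max 0 (- f t) * indicator {x<..} t)
        = (LBINT t:{x<..}. f t)"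
      unfolding set_lebesgue_integral_def
      by (subst Bochner_Integration.integral_diff[OF intP intN, symmetric])
        (auto intro!: Bochner_Integration.integral_cong simp: max_def indicator_def)
    then show "emeasure (density lborel ?P) {x<..} = emeasure (density lborel ?N) {x<..}"
      using em[OF f] em[of "\<lambda>t. - f t"] f zero[of x] by simp
  qed auto
  then have "AE t in lborel. ?P t = ?N t"
    by (subst (asm) sigma_finite_measure.density_unique_iff[OF sigma_finite_lborel]) auto
  then show ?thesis
  proof (rule AE_mp, intro AE_I2 impI)
    fix t assume "?P t = ?N t"
    then show "f t = 0"
      by (cases "f t \<ge> 0") (auto simp: ennreal_neg)
  qed
qed

text \<open>Cut off to zero outside the interval, \<open>f - a\<close> has vanishing integral over
  every half-line, as a difference of two of the given integrals. This route bypasses the Lebesgue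
  differentiation theorem.\<close>

lemma AE_const_if_indefinite_integral_linear:
  fixes f :: "real \<Rightarrow> real"
  assumes f: "set_integrable lborel {0..T} f"
    and lin: "\<And>t. t \<in> {0..T} \<Longrightarrow> (LBINT s:{0..t}. f s) = t * a"
  shows "AE t in lborel. t \<in> {0..T} \<longrightarrow> f t = a"
proof -
  let ?g = "\<lambda>t. indicator {0..T} t * (f t - a)"
  have const: "set_integrable lborel {0..t} (\<lambda>_. a)" for t :: real
    by (rule borel_integrable_atLeastAtMost') auto
  have sub: "set_integrable lborel {x..y} f" if "0 \<le> x" "y \<le> T" for x y
    using that by (intro set_integrable_subset[OF f]) auto
  have diff: "set_integrable lborel {0..t} (\<lambda>t. f t - a)" if "t \<le> T" for t
    using sub[OF _ that, of 0] const[of t] by (intro set_integral_diff) auto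
  have g: "integrable lborel ?g"
    using diff[of T] by (simp add: set_integrable_def)
  have zero: "(LBINT s:{0..t}. f s - a) = 0" if "t \<in> {0..T}" for t
    using that lin[OF that] sub[of 0 t] const[of t]
    by (subst set_integral_diff) (auto simp: set_lebesgue_integral_def)
  have "(LBINT t:{x<..}. ?g t) = 0" for x
  proof -
    consider "x < 0" | "x \<in> {0..T}" | "x > T" "x \<ge> 0"
      by force
    then show ?thesis
    proof cases
      case 1
      show ?thesis
      proof (cases "T \<ge> 0")
        case True
        have "(LBINT t:{x<..}. ?g t) = (LBINT s:{0..T}. f s - a)"
          unfolding set_lebesgue_integral_def using 1
          by (intro Bochner_Integration.integral_cong) (auto simp: indicator_def)
        then show ?thesis
          using zero[of T] True by simp
      qed (simp add: set_lebesgue_integral_def)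
    next
      case 2
      have "(LBINT t:{x<..}. ?g t) = (LBINT s:{0..T}. f s - a) - (LBINT s:{0..x}. f s - a)"
        unfolding set_lebesgue_integral_def using 2
        by (subst Bochner_Integration.integral_diff[OF diff[unfolded set_integrable_def]
              diff[unfolded set_integrable_def], symmetric])
          (auto intro!: Bochner_Integration.integral_cong simp: indicator_def)
      then show ?thesis
        using zero[of T] zero[OF 2] 2 by simp
    next
      case 3
      then have "(LBINT t:{x<..}. ?g t) = (LINT t|(lborel :: real measure). 0)"
        unfolding set_lebesgue_integral_def
        by (intro Bochner_Integration.integral_cong) (auto simp: indicator_def)
      then show ?thesis
        by simp
    qed
  qed
  then have "AE t in lborel. ?g t = 0"
    by (intro AE_zero_if_set_integral_greaterThan_zero[OF g]) simp
  then show ?thesis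
    by (rule AE_mp) (auto intro!: AE_I2 simp: indicator_def)
qed

section \<open>The Neyman--Pearson lemma\<close>

text \<open>The product \<open>?h\<close> of \<open>indicator R - indicator S\<close> and
  \<open>L - \<kappa>\<close> is nonnegative pointwise, and its integral is the gain in power minus
  \<open>\<kappa>\<close> times the gain in size. If the power does not drop from \<open>R\<close>
  to \<open>S\<close>, that integral is 0, so \<open>?h\<close> vanishes almost everywhere.\<close>

lemma neyman_pearson:
  fixes L :: "'a \<Rightarrow> real"
  assumes "finite_measure M" and L: "integrable M L" and R: "R \<in> sets M" and S: "S \<in> sets M"
    and "0 \<le> \<kappa>" and inside: "\<And>\<omega>. \<omega> \<in> R \<Longrightarrow> \<kappa> \<le> L \<omega>"
    and outside: "\<And>\<omega>. \<omega> \<in> space M - R \<Longrightarrow> L \<omega> \<le> \<kappa>"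
    and size: "measure M S \<le> measure M R"
  shows "(LINT \<omega>:S|M. L \<omega>) \<le> (LINT \<omega>:R|M. L \<omega>)"
    and "(LINT \<omega>:R|M. L \<omega>) \<le> (LINT \<omega>:S|M. L \<omega>) \<Longrightarrow> AE \<omega> in M. L \<omega> = \<kappa> \<or> (\<omega> \<in> S \<longleftrightarrow> \<omega> \<in> R)"
proof -
  interpret finite_measure M by fact
  let ?h = "\<lambda>\<omega>. (indicator R \<omega> - indicator S \<omega>) * (L \<omega> - \<kappa>)"
  have i: "integrable M (\<lambda>\<omega>. indicator A \<omega> * L \<omega>)" "integrable M (\<lambda>\<omega>. indicator A \<omega> * \<kappa>)"
    if "A \<in> sets M" for A
    using that L integrable_mult_indicator[of A M L] integrable_real_mult_indicator[of A M "\<lambda>_. \<kappa>"]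
    by (auto simp: mult.commute)
  have eq: "?h = (\<lambda>\<omega>. (indicator R \<omega> * L \<omega> - indicator S \<omega> * L \<omega>)
      - (indicator R \<omega> * \<kappa> - indicator S \<omega> * \<kappa>))"
    by (auto simp: algebra_simps)
  have h: "integrable M ?h"
    unfolding eq using i R S by (intro Bochner_Integration.integrable_diff) auto
  have int: "(LINT \<omega>|M. ?h \<omega>) = (LINT \<omega>:R|M. L \<omega>) - (LINT \<omega>:S|M. L \<omega>)
      - (\<kappa> * measure M R - \<kappa> * measure M S)"
    unfolding eq set_lebesgue_integral_def using i[OF R] i[OF S] R S by simp
  have nonneg: "0 \<le> ?h \<omega>" if "\<omega> \<in> space M" for \<omega>
    using inside[of \<omega>] outside[of \<omega>] that by (auto simp: indicator_def)
  then have "0 \<le> (LINT \<omega>|M. ?h \<omega>)"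
    by (intro Bochner_Integration.integral_nonneg) auto
  moreover have gap: "\<kappa> * measure M S \<le> \<kappa> * measure M R"
    using size \<open>0 \<le> \<kappa>\<close> by (rule mult_left_mono)
  ultimately show "(LINT \<omega>:S|M. L \<omega>) \<le> (LINT \<omega>:R|M. L \<omega>)"
    using int by linarith
  assume "(LINT \<omega>:R|M. L \<omega>) \<le> (LINT \<omega>:S|M. L \<omega>)"
  with \<open>0 \<le> (LINT \<omega>|M. ?h \<omega>)\<close> int gap have "(LINT \<omega>|M. ?h \<omega>) = 0"
    by linarith
  then have "AE \<omega> in M. ?h \<omega> = 0"
    using nonneg by (subst (asm) integral_nonneg_eq_0_iff_AE[OF h]) auto
  then show "AE \<omega> in M. L \<omega> = \<kappa> \<or> (\<omega> \<in> S \<longleftrightarrow> \<omega> \<in> R)"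
    by (rule AE_mp) (auto intro!: AE_I2 simp: indicator_def split: if_splits)
qed

section \<open>Brownian motion with constant drift\<close>

text \<open>Completing the square shows that the exponential weight turns a centred normal density
  of variance s^2 into the one with mean a s^2 and the same variance. Independence carries this over
  to finitely many coordinates.\<close>

lemma (in prob_space) indep_normal_tilt:
  fixes X :: "'i \<Rightarrow> 'a \<Rightarrow> real" and a :: real
  assumes "finite I" and indep: "indep_vars (\<lambda>_. borel) X I"
    and \<sigma>: "\<And>i. i \<in> I \<Longrightarrow> 0 < \<sigma> i"
    and normal: "\<And>i. i \<in> I \<Longrightarrow> distributed M lborel (X i) (normal_density 0 (\<sigma> i))"
  shows "distr (density M (\<lambda>\<omega>. \<Prod>i\<in>I. ennreal (exp (a * X i \<omega> - a\<^sup>2 * (\<sigma> i)\<^sup>2 / 2))))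
      (PiM I (\<lambda>_. borel)) (\<lambda>\<omega>. \<lambda>i\<in>I. X i \<omega>)
    = distr M (PiM I (\<lambda>_. borel)) (\<lambda>\<omega>. \<lambda>i\<in>I. X i \<omega> + a * (\<sigma> i)\<^sup>2)"
    (is "distr (density M ?L) ?P ?X = distr M ?P ?Y")
proof -
  have [measurable]: "X i \<in> borel_measurable M" if "i \<in> I" for i
    using indep that by (auto simp: indep_vars_def2)
  have [measurable]: "?X \<in> measurable M ?P" "?Y \<in> measurable M ?P" "?L \<in> borel_measurable M"
    by measurable
  interpret Y: prob_space "distr M ?P ?Y"
    by (rule prob_space_distr) measurable
  have one: "(\<integral>\<^sup>+\<omega>. ennreal (exp (a * X i \<omega> - a\<^sup>2 * (\<sigma> i)\<^sup>2 / 2)) * indicator (A i) (X i \<omega>) \<partial>M)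
      = emeasure M {\<omega> \<in> space M. X i \<omega> + a * (\<sigma> i)\<^sup>2 \<in> A i}"
    if i: "i \<in> I" and [measurable]: "A i \<in> sets borel" for A :: "'i \<Rightarrow> real set" and i
  proof -
    note n = normal[OF i] and s = \<sigma>[OF i]
    have Z: "distributed M lborel (\<lambda>\<omega>. a * (\<sigma> i)\<^sup>2 + 1 * X i \<omega>)
        (normal_density (a * (\<sigma> i)\<^sup>2 + 1 * 0) (\<bar>1\<bar> * \<sigma> i))"
      by (rule normal_density_affine[OF n s]) auto
    have dens: "normal_density 0 (\<sigma> i) x * exp (a * x - a\<^sup>2 * (\<sigma> i)\<^sup>2 / 2)
        = normal_density (a * (\<sigma> i)\<^sup>2) (\<sigma> i) x" for x
    proof -
      have "- (x - 0)\<^sup>2 / (2 * (\<sigma> i)\<^sup>2) + (a * x - a\<^sup>2 * (\<sigma> i)\<^sup>2 / 2)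
          = - (x - a * (\<sigma> i)\<^sup>2)\<^sup>2 / (2 * (\<sigma> i)\<^sup>2)"
        using s by (simp add: field_simps power2_eq_square)
      then show ?thesis
        by (simp add: normal_density_def exp_add[symmetric])
    qed
    have "(\<integral>\<^sup>+\<omega>. ennreal (exp (a * X i \<omega> - a\<^sup>2 * (\<sigma> i)\<^sup>2 / 2)) * indicator (A i) (X i \<omega>) \<partial>M)
        = (\<integral>\<^sup>+x. ennreal (normal_density 0 (\<sigma> i) x) *
            (ennreal (exp (a * x - a\<^sup>2 * (\<sigma> i)\<^sup>2 / 2)) * indicator (A i) x) \<partial>lborel)"
      by (rule distributed_nn_integral[OF n, symmetric]) measurable
    also have "\<dots> = (\<integral>\<^sup>+x. ennreal (normal_density (a * (\<sigma> i)\<^sup>2) (\<sigma> i) x) * indicator (A i) x \<partial>lborel)"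
      by (simp add: dens[symmetric] ennreal_mult normal_density_nonneg mult_ac)
    also have "\<dots> = (\<integral>\<^sup>+\<omega>. indicator (A i) (a * (\<sigma> i)\<^sup>2 + 1 * X i \<omega>) \<partial>M)"
      using distributed_nn_integral[OF Z, of "indicator (A i)"] by simp
    also have "\<dots> = (\<integral>\<^sup>+\<omega>. indicator {\<omega> \<in> space M. X i \<omega> + a * (\<sigma> i)\<^sup>2 \<in> A i} \<omega> \<partial>M)"
      by (intro nn_integral_cong) (auto simp: indicator_def add.commute)
    also have "\<dots> = emeasure M {\<omega> \<in> space M. X i \<omega> + a * (\<sigma> i)\<^sup>2 \<in> A i}"
      using i by (subst nn_integral_indicator) auto
    finally show ?thesis .
  qed
  show ?thesis
  \<comment> \<open>Boxes determine the measure, and on a box both sides are expectations of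
    products with one factor per coordinate, which independence splits.\<close>
  proof (rule measure_eqI_PiM_finite[OF \<open>finite I\<close>, symmetric])
    fix A :: "'i \<Rightarrow> real set" assume A: "\<And>i. i \<in> I \<Longrightarrow> A i \<in> sets borel"
    have [measurable]: "Pi\<^sub>E I A \<in> sets ?P"
      using A \<open>finite I\<close> by (auto intro: sets_PiM_I_finite)
    have "emeasure (distr (density M ?L) ?P ?X) (Pi\<^sub>E I A)
        = (\<integral>\<^sup>+\<omega>. ?L \<omega> * indicator (?X -` Pi\<^sub>E I A \<inter> space M) \<omega> \<partial>M)"
      by (subst emeasure_distr, measurable) (subst emeasure_density, auto)
    also have "\<dots> = (\<integral>\<^sup>+\<omega>. (\<Prod>i\<in>I. ennreal (exp (a * X i \<omega> - a\<^sup>2 * (\<sigma> i)\<^sup>2 / 2)) * indicator (A i) (X i \<omega>)) \<partial>M)"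
      using \<open>finite I\<close>
      by (intro nn_integral_cong) (auto simp: prod.distrib PiE_iff indicator_def prod_zero_iff)
    also have "\<dots> = (\<Prod>i\<in>I. \<integral>\<^sup>+\<omega>. ennreal (exp (a * X i \<omega> - a\<^sup>2 * (\<sigma> i)\<^sup>2 / 2)) * indicator (A i) (X i \<omega>) \<partial>M)"
      using A by (intro indep_vars_nn_integral[OF \<open>finite I\<close>] indep_vars_compose2[OF indep]) auto
    also have "\<dots> = (\<Prod>i\<in>I. emeasure M {\<omega> \<in> space M. X i \<omega> + a * (\<sigma> i)\<^sup>2 \<in> A i})"
      using A by (intro prod.cong refl one) auto
    also have "\<dots> = (\<Prod>i\<in>I. \<integral>\<^sup>+\<omega>. indicator (A i) (X i \<omega> + a * (\<sigma> i)\<^sup>2) \<partial>M)"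
    proof (intro prod.cong refl)
      fix i assume i: "i \<in> I"
      have [measurable]: "A i \<in> sets borel" using A i by auto
      have "emeasure M {\<omega> \<in> space M. X i \<omega> + a * (\<sigma> i)\<^sup>2 \<in> A i}
          = (\<integral>\<^sup>+\<omega>. indicator {\<omega> \<in> space M. X i \<omega> + a * (\<sigma> i)\<^sup>2 \<in> A i} \<omega> \<partial>M)"
        using i by (subst nn_integral_indicator) auto
      also have "\<dots> = (\<integral>\<^sup>+\<omega>. indicator (A i) (X i \<omega> + a * (\<sigma> i)\<^sup>2) \<partial>M)"
        by (intro nn_integral_cong) (auto simp: indicator_def)
      finally show "emeasure M {\<omega> \<in> space M. X i \<omega> + a * (\<sigma> i)\<^sup>2 \<in> A i}
          = (\<integral>\<^sup>+\<omega>. indicator (A i) (X i \<omega> + a * (\<sigma> i)\<^sup>2) \<partial>M)" .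
    qed
    also have "\<dots> = (\<integral>\<^sup>+\<omega>. (\<Prod>i\<in>I. indicator (A i) (X i \<omega> + a * (\<sigma> i)\<^sup>2)) \<partial>M)"
      using A by (intro indep_vars_nn_integral[OF \<open>finite I\<close>, symmetric] indep_vars_compose2[OF indep]) auto
    also have "\<dots> = (\<integral>\<^sup>+\<omega>. indicator (?Y -` Pi\<^sub>E I A \<inter> space M) \<omega> \<partial>M)"
      using \<open>finite I\<close>
      by (intro nn_integral_cong) (auto simp: PiE_iff indicator_def prod_zero_iff)
    also have "\<dots> = emeasure (distr M ?P ?Y) (Pi\<^sub>E I A)"
      by (simp add: emeasure_distr)
    finally show "emeasure (distr M ?P ?Y) (Pi\<^sub>E I A)
        = emeasure (distr (density M ?L) ?P ?X) (Pi\<^sub>E I A)" ..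
  next
    show "range (\<lambda>_::nat. Pi\<^sub>E I (\<lambda>_. UNIV)) \<subseteq> prod_algebra I (\<lambda>_. borel :: real measure)"
      using \<open>finite I\<close> by (auto intro!: prod_algebraI_finite)
  qed (auto simp: space_PiM)
qed

text \<open>This turns a finite set of times into a grid for \<open>indep_increments\<close>.
  Strictness gives each increment a positive variance, as \<open>normal_increments\<close>
  demands.\<close>

lemma finite_set_strict_mono_enumeration:
  fixes K :: "real set"
  assumes "finite K" "K \<subseteq> {a..b}" "a \<in> K" "b \<in> K"
  obtains n :: nat and \<tau> where "strict_mono_on {0..n} \<tau>" "\<tau> ` {0..n} = K" "\<tau> 0 = a" "\<tau> n = b"
proof -
  define xs where "xs = sorted_list_of_set K"
  define n where "n = length xs - 1"
  have set: "set xs = K" and sorted: "sorted_wrt (<) xs"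
    using assms by (simp_all add: xs_def)
  have len: "length xs = Suc n"
    using set assms(3) by (cases xs) (auto simp: n_def)
  have "strict_mono_on {0..n} ((!) xs)"
    using sorted len by (auto simp: strict_mono_on_def sorted_wrt_iff_nth_less)
  moreover have img: "(!) xs ` {0..n} = K"
    unfolding set[symmetric] set_conv_nth len by (auto simp: less_Suc_eq_le)
  moreover have le: "xs ! i \<le> xs ! j" if "i \<le> j" "j \<le> n" for i j
    using that len sorted by (cases "i = j") (auto simp: sorted_wrt_iff_nth_less less_imp_le)
  moreover have "xs ! 0 = a"
  proof (rule antisym)
    obtain k where "k \<le> n" "xs ! k = a"
      using img assms(3) by auto
    then show "xs ! 0 \<le> a"
      using le[of 0 k] by simp
    show "a \<le> xs ! 0"
      using img assms(2) by force
  qed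
  moreover have "xs ! n = b"
  proof (rule antisym)
    obtain k where "k \<le> n" "xs ! k = b"
      using img assms(4) by auto
    then show "b \<le> xs ! n"
      using le[of k n] by simp
    show "xs ! n \<le> b"
      using img assms(2) by force
  qed
  ultimately show thesis
    using that by blast
qed

section \<open>Trajectories as random elements of the path space\<close>

lemma set_integral_const_Icc:
  fixes a t :: real
  assumes "0 \<le> t"
  shows "(LBINT s:{0..t}. a) = a * t"
  using assms by (simp add: set_lebesgue_integral_def)

lemma attack_signal_const: "attack_signal T (\<lambda>_. a)"
  unfolding attack_signal_def by (rule borel_integrable_atLeastAtMost') auto

lemma attack_signal_integrable_Icc:
  assumes "attack_signal T \<theta>" "t \<le> T"
  shows "set_integrable lborel {0..t} \<theta>"
  using assms unfolding attack_signal_def by (elim set_integrable_subset) auto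

text \<open>Continuity is a known fact for the gauge integral, which agrees with the Lebesgue
  integral on every initial interval. It places the trajectories in C[0,T].\<close>

lemma continuous_on_signal_integral:
  assumes "attack_signal T \<theta>"
  shows "continuous_on {0..T} (\<lambda>t. LBINT s:{0..t}. \<theta> s)"
proof -
  have "continuous_on {0..T} (\<lambda>t. integral {0..t} \<theta>)"
    using assms unfolding attack_signal_def
    by (intro indefinite_integral_continuous_1 set_borel_integral_eq_integral)
  then show ?thesis
    by (rule continuous_on_eq)
      (auto intro!: set_borel_integral_eq_integral(2)[symmetric] attack_signal_integrable_Icc[OF assms])
qed

lemma measurable_path_eval [measurable]:
  assumes "t \<in> {0..T}"
  shows "(\<lambda>x. x t) \<in> borel_measurable (path_space T)"
  unfolding path_space_def
  by (rule measurable_restrict_space1) (rule measurable_component_singleton[OF assms])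

context std_brownian_motion
begin

lemma trajectory_const:
  "trajectory T w (\<lambda>_. a) \<omega> = (\<lambda>t\<in>{0..T}. a * t + w t \<omega>)"
  unfolding trajectory_def by (auto simp: set_integral_const_Icc intro!: restrict_ext)

lemma trajectory_apply:
  assumes "t \<in> {0..T}"
  shows "trajectory T w \<theta> \<omega> t = (LBINT s:{0..t}. \<theta> s) + w t \<omega>"
  using assms by (simp add: trajectory_def)

lemma measurable_trajectory_PiM [measurable]:
  "trajectory T w \<theta> \<in> measurable M (\<Pi>\<^sub>M t\<in>{0..T}. borel)"
  unfolding trajectory_def using measurable_w by (intro measurable_restrict) auto

lemma continuous_on_trajectory:
  assumes "attack_signal T \<theta>" "\<omega> \<in> space M"
  shows "continuous_on {0..T} (trajectory T w \<theta> \<omega>)"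
proof -
  have "continuous_on {0..T} (\<lambda>t. (LBINT s:{0..t}. \<theta> s) + w t \<omega>)"
    using continuous_on_signal_integral[OF assms(1)] continuous_paths[OF assms(2)]
    by (rule continuous_on_add)
  then show ?thesis
    by (rule continuous_on_eq) (simp add: trajectory_apply)
qed

lemma measurable_trajectory:
  assumes "attack_signal T \<theta>"
  shows "trajectory T w \<theta> \<in> measurable M (path_space T)"
  unfolding path_space_def
  using continuous_on_trajectory[OF assms]
  by (intro measurable_restrict_space2 measurable_trajectory_PiM) auto

lemmas measurable_trajectory_const [measurable] = measurable_trajectory[OF attack_signal_const]

section \<open>Change of measure for a constant drift\<close>

text \<open>This is the Cameron-Martin formula for a linear drift. Cylinder sets determine a finite
  measure on the product space, and a cylinder involves only finitely many increments, to which
  \<open>indep_normal_tilt\<close> applies. The product of their weights telescopes to a function of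
  \<open>w T\<close> alone.\<close>

lemma tilted_path_law:
  assumes "0 < T"
  shows "distr (density M (\<lambda>\<omega>. ennreal (exp (a * w T \<omega> - a\<^sup>2 * T / 2))))
      (\<Pi>\<^sub>M t\<in>{0..T}. borel) (trajectory T w (\<lambda>_. 0))
    = distr M (\<Pi>\<^sub>M t\<in>{0..T}. borel) (trajectory T w (\<lambda>_. a))"
    (is "distr (density M ?L) ?Q _ = _")
proof (rule measure_eqI_PiM_infinite[symmetric])
  have "prob_space (distr M ?Q (trajectory T w (\<lambda>_. a)))"
    by (rule prob_space_distr) measurable
  then show "finite_measure (distr M ?Q (trajectory T w (\<lambda>_. a)))"
    by (rule prob_space.finite_measure)
  fix A :: "real \<Rightarrow> real set" and J
  assume J: "finite J" "J \<subseteq> {0..T}" and A: "\<And>j. j \<in> J \<Longrightarrow> A j \<in> sets borel"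
  \<comment> \<open>Adding 0 and \<open>T\<close> to the times of the cylinder makes the increments
    start from \<open>w 0\<close>, which is 0, and makes the weight end at \<open>w T\<close>
    whatever \<open>J\<close> is.\<close>
  obtain n :: nat and \<tau> where mono: "strict_mono_on {0..n} \<tau>"
    and img: "\<tau> ` {0..n} = insert 0 (insert T J)" and ends: "\<tau> 0 = 0" "\<tau> n = T"
    using finite_set_strict_mono_enumeration[of "insert 0 (insert T J)" 0 T] J assms by auto
  have "\<forall>j\<in>J. \<exists>k\<in>{0..n}. \<tau> k = j"
    using img by (metis imageE insertCI)
  then obtain k where k: "\<And>j. j \<in> J \<Longrightarrow> k j \<le> n" "\<And>j. j \<in> J \<Longrightarrow> \<tau> (k j) = j"
    by (metis atLeastAtMost_iff)
  have \<tau>: "\<tau> i \<in> {0..T}" if "i \<le> n" for i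
  proof -
    have "\<tau> i \<in> \<tau> ` {0..n}" using that by auto
    then show ?thesis using img J assms by auto
  qed
  have step: "\<tau> i < \<tau> (Suc i)" if "i < n" for i
    using strict_mono_onD[OF mono, of i "Suc i"] that by auto
  let ?\<Delta> = "\<lambda>i \<omega>. w (\<tau> (Suc i)) \<omega> - w (\<tau> i) \<omega>"
  let ?\<sigma> = "\<lambda>i. sqrt (\<tau> (Suc i) - \<tau> i)"
  let ?P = "\<Pi>\<^sub>M i\<in>{..<n}. (borel :: real measure)"
  \<comment> \<open>The square of \<open>?\<sigma> i\<close> is the length of the time step, so
    \<open>?Y b\<close> lists the increments of the trajectory with drift \<open>b\<close>.\<close>
  let ?Y = "\<lambda>b \<omega>. \<lambda>i\<in>{..<n}. ?\<Delta> i \<omega> + b * (?\<sigma> i)\<^sup>2"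
  \<comment> \<open>The cylinder \<open>?E\<close> in terms of increments: \<open>k j\<close> is the
    position of \<open>j\<close> in the grid, so the value at time \<open>j\<close> is the sum of
    the increments with index below \<open>k j\<close>.\<close>
  let ?B = "{y \<in> space ?P. \<forall>j\<in>J. (\<Sum>i<k j. y i) \<in> A j}"
  let ?E = "prod_emb {0..T} (\<lambda>_. borel) J (Pi\<^sub>E J A)"
  have \<Delta>_measurable: "?\<Delta> i \<in> borel_measurable M" if "i < n" for i
    using \<tau>[of i] \<tau>[of "Suc i"] that measurable_w by auto
  have Y_measurable: "?Y b \<in> measurable M ?P" for b
    using \<Delta>_measurable by (intro measurable_restrict) auto
  have B: "?B \<in> sets ?P"
  proof (rule sets.sets_Collect_finite_All[OF _ \<open>finite J\<close>])
    fix j assume j: "j \<in> J"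
    have "(\<lambda>y. \<Sum>i<k j. y i) \<in> borel_measurable ?P"
      using k(1)[OF j] by (intro borel_measurable_sum measurable_component_singleton) auto
    from measurable_sets[OF this A[OF j]]
    show "{y \<in> space ?P. (\<Sum>i<k j. y i) \<in> A j} \<in> sets ?P"
      by (simp add: vimage_def Collect_conj_eq Int_commute)
  qed
  have E: "?E \<in> sets ?Q"
    using J A by (intro sets_PiM_I) auto
  have partial_sum: "(\<Sum>i<k j. ?Y b \<omega> i) = b * j + w j \<omega>" if j: "j \<in> J" and "\<omega> \<in> space M" for b j \<omega>
  proof -
    have "(\<Sum>i<k j. ?Y b \<omega> i) = (\<Sum>i<k j. (b * \<tau> (Suc i) + w (\<tau> (Suc i)) \<omega>) - (b * \<tau> i + w (\<tau> i) \<omega>))"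
      using k(1)[OF j] step by (intro sum.cong) (auto simp: algebra_simps less_imp_le)
    also have "\<dots> = b * j + w j \<omega>"
      using sum_lessThan_telescope[of "\<lambda>i. b * \<tau> i + w (\<tau> i) \<omega>" "k j"] ends k(2)[OF j] w_0[OF \<open>\<omega> \<in> space M\<close>]
      by simp
    finally show ?thesis .
  qed
  have preimages: "?Y b -` ?B \<inter> space M = trajectory T w (\<lambda>_. b) -` ?E \<inter> space M" for b
    using J partial_sum
    by (auto simp: trajectory_const prod_emb_def space_PiM PiE_iff restrict_def[symmetric] subset_iff)
  \<comment> \<open>\<open>N\<close> stays open because the identity serves twice, for
    \<open>M\<close> with drift \<open>a\<close> and for the tilted measure with drift 0.\<close>
  have key: "emeasure (distr N ?Q (trajectory T w (\<lambda>_. b))) ?E = emeasure (distr N ?P (?Y b)) ?B"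
    if "sets N = sets M" for N b
  proof -
    have "space N = space M"
      by (rule sets_eq_imp_space_eq[OF that])
    then show ?thesis
      using that E B Y_measurable[of b] preimages[of b]
      by (subst (1 2) emeasure_distr) (auto simp: measurable_cong_sets[OF that refl])
  qed
  have indep: "indep_vars (\<lambda>_. borel) ?\<Delta> {..<n}"
    using strict_mono_on_imp_mono_on[OF mono] \<tau> by (intro indep_increments) auto
  have normal: "distributed M lborel (?\<Delta> i) (normal_density 0 (?\<sigma> i))" if "i < n" for i
    using that \<tau>[of i] \<tau>[of "Suc i"] step[OF that] by (intro normal_increments) auto
  have likelihood: "(\<Prod>i<n. ennreal (exp (a * ?\<Delta> i \<omega> - a\<^sup>2 * (?\<sigma> i)\<^sup>2 / 2))) = ?L \<omega>"
    if "\<omega> \<in> space M" for \<omega>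
  proof -
    have "(\<Sum>i<n. a * ?\<Delta> i \<omega> - a\<^sup>2 * (?\<sigma> i)\<^sup>2 / 2)
        = (\<Sum>i<n. (a * w (\<tau> (Suc i)) \<omega> - a\<^sup>2 * \<tau> (Suc i) / 2) - (a * w (\<tau> i) \<omega> - a\<^sup>2 * \<tau> i / 2))"
      using step by (intro sum.cong) (auto simp: field_simps less_imp_le)
    also have "\<dots> = a * w T \<omega> - a\<^sup>2 * T / 2"
      using sum_lessThan_telescope[of "\<lambda>i. a * w (\<tau> i) \<omega> - a\<^sup>2 * \<tau> i / 2" n] ends w_0[OF that]
      by simp
    finally show ?thesis
      by (simp add: prod_ennreal exp_sum[symmetric])
  qed
  have "density M ?L = density M (\<lambda>\<omega>. \<Prod>i<n. ennreal (exp (a * ?\<Delta> i \<omega> - a\<^sup>2 * (?\<sigma> i)\<^sup>2 / 2)))"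
  proof (rule density_cong)
    show "?L \<in> borel_measurable M"
      using measurable_w[of T] assms by simp
    show "(\<lambda>\<omega>. \<Prod>i<n. ennreal (exp (a * ?\<Delta> i \<omega> - a\<^sup>2 * (?\<sigma> i)\<^sup>2 / 2))) \<in> borel_measurable M"
    proof (rule borel_measurable_prod_ennreal)
      fix i assume "i \<in> {..<n}"
      then have "?\<Delta> i \<in> borel_measurable M"
        using \<Delta>_measurable by simp
      from measurable_compose[OF this, of "\<lambda>x. ennreal (exp (a * x - a\<^sup>2 * (?\<sigma> i)\<^sup>2 / 2))" borel]
      show "(\<lambda>\<omega>. ennreal (exp (a * ?\<Delta> i \<omega> - a\<^sup>2 * (?\<sigma> i)\<^sup>2 / 2))) \<in> borel_measurable M"
        by simp
    qed
  qed (auto intro!: AE_I2 simp: likelihood)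
  then have "distr (density M ?L) ?P (?Y 0) = distr M ?P (?Y a)"
    using indep_normal_tilt[OF _ indep, of ?\<sigma> a] normal step by simp
  then show "emeasure (distr M ?Q (trajectory T w (\<lambda>_. a))) ?E
      = emeasure (distr (density M ?L) ?Q (trajectory T w (\<lambda>_. 0))) ?E"
    by (simp only: key sets_density)
qed auto

text \<open>A measurable set of paths is the trace of a set of the product sigma-algebra on the
  continuous functions. Trajectories are always continuous, so both sets define the same event and
  \<open>tilted_path_law\<close> carries over.\<close>

lemma emeasure_trajectory_tilt:
  assumes "0 < T" and N: "N \<in> sets (path_space T)"
  shows "emeasure M {\<omega> \<in> space M. trajectory T w (\<lambda>_. a) \<omega> \<in> N}
    = (\<integral>\<^sup>+\<omega>. ennreal (exp (a * w T \<omega> - a\<^sup>2 * T / 2))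
        * indicator {\<omega> \<in> space M. trajectory T w (\<lambda>_. 0) \<omega> \<in> N} \<omega> \<partial>M)"
proof -
  let ?L = "\<lambda>\<omega>. ennreal (exp (a * w T \<omega> - a\<^sup>2 * T / 2))"
  let ?Q = "\<Pi>\<^sub>M t\<in>{0..T}. (borel :: real measure)"
  have [measurable]: "w T \<in> borel_measurable M"
    using measurable_w assms(1) by auto
  obtain A where A [measurable]: "A \<in> sets ?Q" and N_eq: "N = {x. continuous_on {0..T} x} \<inter> A"
    using N by (auto simp: path_space_def sets_restrict_space)
  have vimage: "{\<omega> \<in> space M. trajectory T w (\<lambda>_. b) \<omega> \<in> N}
      = trajectory T w (\<lambda>_. b) -` A \<inter> space M" for b
    using continuous_on_trajectory[OF attack_signal_const] by (auto simp: N_eq)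
  have "emeasure M (trajectory T w (\<lambda>_. a) -` A \<inter> space M)
      = emeasure (distr M ?Q (trajectory T w (\<lambda>_. a))) A"
    by (simp add: emeasure_distr)
  also have "\<dots> = emeasure (distr (density M ?L) ?Q (trajectory T w (\<lambda>_. 0))) A"
    by (simp only: tilted_path_law[OF \<open>0 < T\<close>])
  also have "\<dots> = emeasure (density M ?L) (trajectory T w (\<lambda>_. 0) -` A \<inter> space M)"
    by (simp add: emeasure_distr)
  also have "\<dots> = (\<integral>\<^sup>+\<omega>. ?L \<omega> * indicator (trajectory T w (\<lambda>_. 0) -` A \<inter> space M) \<omega> \<partial>M)"
    by (rule emeasure_density) measurable
  finally show ?thesis
    unfolding vimage .
qed

text \<open>Taking the whole path space in \<open>emeasure_trajectory_tilt\<close> identifies the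
  integral of the likelihood with a probability.\<close>

lemma integrable_likelihood:
  assumes "0 < T"
  shows "integrable M (\<lambda>\<omega>. exp (a * w T \<omega> - a\<^sup>2 * T / 2))"
proof (rule integrableI_bounded)
  show "(\<lambda>\<omega>. exp (a * w T \<omega> - a\<^sup>2 * T / 2)) \<in> borel_measurable M"
    using measurable_w[of T] assms by simp
  have "trajectory T w (\<lambda>_. b) \<omega> \<in> space (path_space T)" if "\<omega> \<in> space M" for b \<omega>
    by (rule measurable_space[OF measurable_trajectory_const that])
  then have "(\<integral>\<^sup>+\<omega>. ennreal (exp (a * w T \<omega> - a\<^sup>2 * T / 2)) \<partial>M)
      = (\<integral>\<^sup>+\<omega>. ennreal (exp (a * w T \<omega> - a\<^sup>2 * T / 2))
        * indicator {\<omega> \<in> space M. trajectory T w (\<lambda>_. 0) \<omega> \<in> space (path_space T)} \<omega> \<partial>M)"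
    by (intro nn_integral_cong) (auto simp: indicator_def)
  also have "\<dots> = emeasure M {\<omega> \<in> space M. trajectory T w (\<lambda>_. a) \<omega> \<in> space (path_space T)}"
    by (rule emeasure_trajectory_tilt[OF assms, symmetric]) simp
  also have "\<dots> < \<infinity>"
    by (simp add: emeasure_eq_measure)
  finally show "(\<integral>\<^sup>+\<omega>. ennreal (norm (exp (a * w T \<omega> - a\<^sup>2 * T / 2))) \<partial>M) < \<infinity>"
    by simp
qed

lemma prob_trajectory_tilt:
  assumes "0 < T" and N: "N \<in> sets (path_space T)"
  shows "prob {\<omega> \<in> space M. trajectory T w (\<lambda>_. a) \<omega> \<in> N}
    = (LINT \<omega>:{\<omega> \<in> space M. trajectory T w (\<lambda>_. 0) \<omega> \<in> N}|M. exp (a * w T \<omega> - a\<^sup>2 * T / 2))"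
proof -
  let ?L = "\<lambda>\<omega>. exp (a * w T \<omega> - a\<^sup>2 * T / 2)"
  let ?S = "{\<omega> \<in> space M. trajectory T w (\<lambda>_. 0) \<omega> \<in> N}"
  have S: "?S \<in> events"
    using N by measurable
  have int: "integrable M (\<lambda>\<omega>. indicator ?S \<omega> * ?L \<omega>)"
    using integrable_mult_indicator[OF S integrable_likelihood[OF assms(1), of a]] by simp
  have "ennreal (prob {\<omega> \<in> space M. trajectory T w (\<lambda>_. a) \<omega> \<in> N})
      = (\<integral>\<^sup>+\<omega>. ennreal (?L \<omega>) * indicator ?S \<omega> \<partial>M)"
    using emeasure_trajectory_tilt[OF assms, of a] by (simp add: emeasure_eq_measure)
  also have "\<dots> = (\<integral>\<^sup>+\<omega>. ennreal (indicator ?S \<omega> * ?L \<omega>) \<partial>M)"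
    by (intro nn_integral_cong) (auto simp: indicator_def)
  also have "\<dots> = ennreal (LINT \<omega>|M. indicator ?S \<omega> * ?L \<omega>)"
    using int by (intro nn_integral_eq_integral) auto
  finally show ?thesis
    unfolding set_lebesgue_integral_def
    by (subst (asm) ennreal_inj) (auto intro!: Bochner_Integration.integral_nonneg)
qed

text \<open>Absolute continuity of the drifted law lets almost sure agreement of two tests pass from
  Brownian motion to the attacked trajectory.\<close>

lemma AE_trajectory_tilt:
  assumes "0 < T" and N: "N \<in> sets (path_space T)"
    and null: "AE \<omega> in M. trajectory T w (\<lambda>_. 0) \<omega> \<notin> N"
  shows "AE \<omega> in M. trajectory T w (\<lambda>_. a) \<omega> \<notin> N"
proof -
  have "emeasure M {\<omega> \<in> space M. trajectory T w (\<lambda>_. a) \<omega> \<in> N} = (\<integral>\<^sup>+\<omega>. 0 \<partial>M)"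
    unfolding emeasure_trajectory_tilt[OF assms(1,2)]
    using null by (intro nn_integral_cong_AE) (auto simp: indicator_def)
  moreover have "{\<omega> \<in> space M. trajectory T w (\<lambda>_. a) \<omega> \<in> N} \<in> events"
    using N by measurable
  ultimately have "{\<omega> \<in> space M. trajectory T w (\<lambda>_. a) \<omega> \<in> N} \<in> null_sets M"
    by (intro null_setsI) simp_all
  then show ?thesis
    by (rule AE_I') auto
qed

end

lemma is_test_sets:
  assumes "is_test T \<phi>"
  shows "{x \<in> space (path_space T). \<phi> x = i} \<in> sets (path_space T)"
proof -
  have \<phi>: "\<phi> \<in> measurable (path_space T) (count_space {0, 1})"
    using assms by (simp add: is_test_def)
  \<comment> \<open>\<open>i\<close> is any natural number; the intersection stays inside the space
    of \<open>count_space {0, 1}\<close>.\<close>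
  have "\<phi> -` ({i} \<inter> {0, 1}) \<inter> space (path_space T) \<in> sets (path_space T)"
    by (rule measurable_sets[OF \<phi>]) auto
  also have "\<phi> -` ({i} \<inter> {0, 1}) \<inter> space (path_space T) = {x \<in> space (path_space T). \<phi> x = i}"
    using measurable_space[OF \<phi>] by auto
  finally show ?thesis .
qed

section \<open>Threshold tests on linear statistics\<close>

text \<open>On paths starting at 0 the statistic is the integral against dx of the step function
  with value \<open>p\<close> up to \<open>t\<close> and \<open>q\<close> from \<open>t\<close> to
  \<open>T\<close>.\<close>

definition linear_test :: "real \<Rightarrow> real \<Rightarrow> real \<Rightarrow> real \<Rightarrow> real \<Rightarrow> (real \<Rightarrow> real) \<Rightarrow> nat" where
  "linear_test T t p q k = (\<lambda>x. if p * x t + q * (x T - x t) \<le> k then 0 else 1)"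

lemma is_test_linear_test:
  assumes "0 \<le> t" "t \<le> T"
  shows "is_test T (linear_test T t p q k)"
proof -
  have [measurable]: "(\<lambda>x. x t) \<in> borel_measurable (path_space T)"
    "(\<lambda>x. x T) \<in> borel_measurable (path_space T)"
    using assms by (auto intro: measurable_path_eval)
  show ?thesis
    unfolding is_test_def linear_test_def by (intro measurable_If) auto
qed

lemma phi_star_eq_linear_test:
  "phi_star T \<epsilon> = linear_test T t 1 1 (sqrt T * Phi_inv (1 - \<epsilon>))"
  by (simp add: phi_star_def linear_test_def)

text \<open>Monotonicity of \<open>Phi\<close> turns the success constraint into a lower bound on
  the integral of the signal, namely the integral of the constant signal
  \<open>theta_star\<close>.\<close>

lemma mem_attacks_iff:
  assumes "0 < T" "0 < c" "c < 1"
  shows "\<theta> \<in> attacks T d c \<longleftrightarrow>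
    attack_signal T \<theta> \<and> T * (1 / sqrt T * Phi_inv c + d) \<le> (LBINT t:{0..T}. \<theta> t)"
proof -
  have "c \<le> success_rate T d \<theta> \<longleftrightarrow> Phi (Phi_inv c) \<le> success_rate T d \<theta>"
    using assms by (simp add: Phi_Phi_inv)
  also have "\<dots> \<longleftrightarrow> (Phi_inv c + sqrt T * d) * sqrt T \<le> (LBINT t:{0..T}. \<theta> t)"
    using assms(1) by (simp add: success_rate_def le_diff_eq pos_le_divide_eq)
  also have "(Phi_inv c + sqrt T * d) * sqrt T = T * (1 / sqrt T * Phi_inv c + d)"
  proof -
    define s where "s = sqrt T"
    have "0 < s" "T = s * s"
      using assms(1) by (auto simp: s_def)
    then show ?thesis
      unfolding s_def[symmetric] by (simp add: field_simps)
  qed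
  finally show ?thesis
    by (auto simp: attacks_def)
qed

text \<open>Needed because \<open>w 0\<close> is known to be 0 only on the sample space, so
  \<open>w t - w 0\<close> and \<open>w t\<close> need not be equal as functions.\<close>

lemma distributed_cong_space:
  assumes "\<And>\<omega>. \<omega> \<in> space M \<Longrightarrow> X \<omega> = Y \<omega>" and "distributed M N X f"
  shows "distributed M N Y f"
proof -
  have "distr M N X = distr M N Y"
    using assms(1) by (intro distr_cong) auto
  moreover have "X \<in> measurable M N \<longleftrightarrow> Y \<in> measurable M N"
    using assms(1) by (intro measurable_cong)
  ultimately show ?thesis
    using assms(2) by (simp add: distributed_def)
qed

section \<open>Error probabilities of linear threshold tests\<close>

context std_brownian_motion
begin

lemma test_outcome_eq:
  assumes "attack_signal T \<theta>"
  shows "{\<omega> \<in> space M. \<phi> (trajectory T w \<theta> \<omega>) = i}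
    = {\<omega> \<in> space M. trajectory T w \<theta> \<omega> \<in> {x \<in> space (path_space T). \<phi> x = i}}"
  using measurable_space[OF measurable_trajectory[OF assms]] by auto

lemma test_outcome_event:
  assumes "is_test T \<phi>" "attack_signal T \<theta>"
  shows "{\<omega> \<in> space M. \<phi> (trajectory T w \<theta> \<omega>) = i} \<in> events"
proof -
  have "trajectory T w \<theta> -` {x \<in> space (path_space T). \<phi> x = i} \<inter> space M \<in> events"
    by (rule measurable_sets[OF measurable_trajectory[OF assms(2)] is_test_sets[OF assms(1)]])
  then show ?thesis
    unfolding test_outcome_eq[OF assms(2)] by (simp add: vimage_def Collect_conj_eq Int_commute)
qed

lemma detection_failure_eq_compl:
  assumes "is_test T \<phi>" "attack_signal T \<theta>"
  shows "detection_failure M T w \<theta> \<phi> = 1 - prob {\<omega> \<in> space M. \<phi> (trajectory T w \<theta> \<omega>) = 1}"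
proof -
  have "\<phi> x \<in> {0, 1}" if "x \<in> space (path_space T)" for x
    using assms(1) that measurable_space[of \<phi>] unfolding is_test_def by fastforce
  then have "\<phi> (trajectory T w \<theta> \<omega>) \<in> {0, 1}" if "\<omega> \<in> space M" for \<omega>
    using measurable_space[OF measurable_trajectory[OF assms(2)] that] by blast
  then have "{\<omega> \<in> space M. \<phi> (trajectory T w \<theta> \<omega>) = 0}
      = space M - {\<omega> \<in> space M. \<phi> (trajectory T w \<theta> \<omega>) = 1}"
    by force
  then show ?thesis
    unfolding detection_failure_def using prob_compl[OF test_outcome_event[OF assms, of 1]] by simp
qed

lemma false_alarm_eq_compl:
  assumes "is_test T \<phi>"
  shows "false_alarm M T w \<phi> = 1 - detection_failure M T w (\<lambda>_. 0) \<phi>"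
  using detection_failure_eq_compl[OF assms attack_signal_const, of 0] by (simp add: false_alarm_def)

text \<open>The increments over the two subintervals are independent normals, so the variances of
  their multiples add up. Nonzero weights keep the scaled laws nondegenerate.\<close>

lemma normal_linear_statistic:
  assumes "0 < t" "t < T" "p \<noteq> 0" "q \<noteq> 0"
  shows "distributed M lborel (\<lambda>\<omega>. p * w t \<omega> + q * (w T \<omega> - w t \<omega>))
    (normal_density 0 (sqrt (p\<^sup>2 * t + q\<^sup>2 * (T - t))))"
proof -
  define \<tau> where "\<tau> = (\<lambda>i::nat. if i = 0 then 0 else if i = 1 then t else T)"
  define r where "r = (\<lambda>i::nat. if i = 0 then p else q)"
  let ?X = "\<lambda>i \<omega>. r i * (w (\<tau> (Suc i)) \<omega> - w (\<tau> i) \<omega>)"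
  let ?\<sigma> = "\<lambda>i. \<bar>r i\<bar> * sqrt (\<tau> (Suc i) - \<tau> i)"
  have two: "{..<2::nat} = {0, 1}"
    by auto
  have r: "r i \<noteq> 0" for i
    using assms by (simp add: r_def)
  have \<tau>: "0 \<le> \<tau> i" "\<tau> i \<le> T" "i < 2 \<Longrightarrow> \<tau> i < \<tau> (Suc i)" for i
    using assms by (auto simp: \<tau>_def)
  have "indep_vars (\<lambda>_. borel) (\<lambda>i \<omega>. w (\<tau> (Suc i)) \<omega> - w (\<tau> i) \<omega>) {..<2}"
    using assms by (intro indep_increments) (auto simp: \<tau>_def mono_on_def)
  then have "indep_vars (\<lambda>_. borel) ?X {..<2}"
    by (rule indep_vars_compose2) auto
  moreover have "distributed M lborel (?X i) (normal_density 0 (?\<sigma> i))" if "i \<in> {..<2}" for i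
    using normal_density_affine[OF normal_increments[of "\<tau> i" "\<tau> (Suc i)"], of "r i" 0]
      \<tau>[of i] \<tau>(2)[of "Suc i"] r[of i] that by simp
  ultimately have "distributed M lborel (\<lambda>\<omega>. \<Sum>i<2. ?X i \<omega>)
      (normal_density (\<Sum>i<2::nat. 0) (sqrt (\<Sum>i<2. (?\<sigma> i)\<^sup>2)))"
    using r \<tau> by (intro sum_indep_normal) (auto simp: lessThan_empty_iff)
  then have "distributed M lborel (\<lambda>\<omega>. p * (w t \<omega> - w 0 \<omega>) + q * (w T \<omega> - w t \<omega>))
      (normal_density 0 (sqrt (p\<^sup>2 * t + q\<^sup>2 * (T - t))))"
    using assms by (simp add: two \<tau>_def r_def power_mult_distrib)
  then show ?thesis
    using assms by (elim distributed_cong_space[rotated]) (simp add: w_0)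
qed

lemma detection_failure_linear_test:
  assumes "0 < t" "t < T" "p \<noteq> 0" "q \<noteq> 0"
  shows "detection_failure M T w \<theta> (linear_test T t p q k)
    = Phi ((k - (p * (LBINT s:{0..t}. \<theta> s) + q * ((LBINT s:{0..T}. \<theta> s) - (LBINT s:{0..t}. \<theta> s))))
        / sqrt (p\<^sup>2 * t + q\<^sup>2 * (T - t)))"
proof -
  let ?\<mu> = "p * (LBINT s:{0..t}. \<theta> s) + q * ((LBINT s:{0..T}. \<theta> s) - (LBINT s:{0..t}. \<theta> s))"
  have "linear_test T t p q k (trajectory T w \<theta> \<omega>) = 0
      \<longleftrightarrow> p * w t \<omega> + q * (w T \<omega> - w t \<omega>) \<le> k - ?\<mu>" for \<omega>
    using assms by (simp add: linear_test_def trajectory_apply algebra_simps)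
  moreover have "0 < sqrt (p\<^sup>2 * t + q\<^sup>2 * (T - t))"
    using assms by (intro real_sqrt_gt_zero add_pos_pos mult_pos_pos) auto
  ultimately show ?thesis
    unfolding detection_failure_def using normal_prob_le[OF normal_linear_statistic[OF assms]] by simp
qed

lemma false_alarm_linear_test:
  assumes "0 < t" "t < T" "p \<noteq> 0" "q \<noteq> 0" "0 < \<epsilon>" "\<epsilon> < 1"
  shows "false_alarm M T w
    (linear_test T t p q (sqrt (p\<^sup>2 * t + q\<^sup>2 * (T - t)) * Phi_inv (1 - \<epsilon>))) = \<epsilon>"
proof -
  have "0 < sqrt (p\<^sup>2 * t + q\<^sup>2 * (T - t))"
    using assms by (intro real_sqrt_gt_zero add_pos_pos mult_pos_pos) auto
  then show ?thesis
    using assms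
    by (simp add: false_alarm_eq_compl is_test_linear_test detection_failure_linear_test
        set_lebesgue_integral_def Phi_Phi_inv)
qed

text \<open>With equal weights the splitting time cancels; \<open>T / 2\<close> is just an interior
  point. Only the total integral of the signal survives.\<close>

lemma detection_failure_phi_star:
  assumes "0 < T"
  shows "detection_failure M T w \<theta> (phi_star T \<epsilon>)
    = Phi (Phi_inv (1 - \<epsilon>) - (LBINT t:{0..T}. \<theta> t) / sqrt T)"
  using detection_failure_linear_test[of "T / 2" 1 1 \<theta> "sqrt T * Phi_inv (1 - \<epsilon>)"] assms
  by (simp add: phi_star_eq_linear_test[of T \<epsilon> "T / 2"] diff_divide_distrib)

lemma false_alarm_phi_star:
  assumes "0 < T" "0 < \<epsilon>" "\<epsilon> < 1"
  shows "false_alarm M T w (phi_star T \<epsilon>) = \<epsilon>"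
  using false_alarm_linear_test[of "T / 2" 1 1 \<epsilon>] assms
  by (simp add: phi_star_eq_linear_test[of T \<epsilon> "T / 2"])

lemma is_test_phi_star: "0 < T \<Longrightarrow> is_test T (phi_star T \<epsilon>)"
  using is_test_linear_test[of 0 T] by (simp add: phi_star_eq_linear_test[of T \<epsilon> 0])

section \<open>Optimality of the terminal value test against a constant drift\<close>

text \<open>The law of \<open>w T\<close> has a density and hence no atoms. This removes the ties
  \<open>L = \<kappa>\<close> left open by the equality case of
  \<open>neyman_pearson\<close>.\<close>

lemma AE_terminal_value_neq:
  assumes "0 < T"
  shows "AE \<omega> in M. w T \<omega> \<noteq> k"
proof -
  have "distributed M lborel (\<lambda>\<omega>. w T \<omega> - w 0 \<omega>) (normal_density 0 (sqrt (T - 0)))"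
    using assms by (intro normal_increments) auto
  then have "AE \<omega> in M. w T \<omega> - w 0 \<omega> \<noteq> k"
    using AE_lborel_singleton[of k] by (subst distributed_AE2) auto
  then show ?thesis
    by (rule AE_mp) (auto intro!: AE_I2 simp: w_0)
qed

text \<open>For \<open>a > 0\<close> the likelihood increases strictly with \<open>w T\<close>, so
  the rejection region of \<open>phi_star\<close> is a likelihood ratio region. It uses up the whole
  level \<open>\<epsilon>\<close>, hence is at least as large as that of any competitor.\<close>

lemma phi_star_most_powerful:
  assumes T: "0 < T" and a: "0 < a" and \<epsilon>: "0 < \<epsilon>" "\<epsilon> < 1" and \<phi>: "\<phi> \<in> tests M T w \<epsilon>"
  shows "detection_failure M T w (\<lambda>_. a) (phi_star T \<epsilon>) \<le> detection_failure M T w (\<lambda>_. a) \<phi>"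
    and "detection_failure M T w (\<lambda>_. a) \<phi> \<le> detection_failure M T w (\<lambda>_. a) (phi_star T \<epsilon>) \<Longrightarrow>
      AE \<omega> in M. phi_star T \<epsilon> (trajectory T w (\<lambda>_. a) \<omega>) = \<phi> (trajectory T w (\<lambda>_. a) \<omega>)"
proof -
  let ?L = "\<lambda>\<omega>. exp (a * w T \<omega> - a\<^sup>2 * T / 2)"
  let ?k = "sqrt T * Phi_inv (1 - \<epsilon>)"
  \<comment> \<open>The critical value is the likelihood on the boundary \<open>w T = ?k\<close> of
    the rejection region.\<close>
  let ?\<kappa> = "exp (a * ?k - a\<^sup>2 * T / 2)"
  let ?reject = "\<lambda>\<psi>. {\<omega> \<in> space M. \<psi> (trajectory T w (\<lambda>_. 0) \<omega>) = (1::nat)}"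
  note star = is_test_phi_star[OF T, of \<epsilon>]
  have test: "is_test T \<phi>" and level: "false_alarm M T w \<phi> \<le> \<epsilon>"
    using \<phi> by (auto simp: tests_def)
  have fail: "detection_failure M T w (\<lambda>_. a) \<psi> = 1 - (LINT \<omega>:?reject \<psi>|M. ?L \<omega>)" if "is_test T \<psi>" for \<psi>
    unfolding detection_failure_eq_compl[OF that attack_signal_const] test_outcome_eq[OF attack_signal_const]
    using prob_trajectory_tilt[OF T is_test_sets[OF that]] by simp
  have reject_star: "\<omega> \<in> ?reject (phi_star T \<epsilon>) \<longleftrightarrow> ?k < w T \<omega>" if "\<omega> \<in> space M" for \<omega>
    using that T by (simp add: phi_star_def trajectory_const)
  have L_le: "?L \<omega> \<le> ?\<kappa> \<longleftrightarrow> w T \<omega> \<le> ?k" "?\<kappa> \<le> ?L \<omega> \<longleftrightarrow> ?k \<le> w T \<omega>" "?L \<omega> = ?\<kappa> \<longleftrightarrow> w T \<omega> = ?k" for \<omega>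
    using a by auto
  have size: "prob (?reject \<phi>) \<le> prob (?reject (phi_star T \<epsilon>))"
    using level false_alarm_phi_star[OF T \<epsilon>] by (simp add: false_alarm_def)
  have inside: "?\<kappa> \<le> ?L \<omega>" if "\<omega> \<in> ?reject (phi_star T \<epsilon>)" for \<omega>
    using that reject_star[of \<omega>] L_le(2)[of \<omega>] by auto
  have outside: "?L \<omega> \<le> ?\<kappa>" if "\<omega> \<in> space M - ?reject (phi_star T \<epsilon>)" for \<omega>
    using that reject_star[of \<omega>] L_le(1)[of \<omega>] by auto
  have np: "(LINT \<omega>:?reject \<phi>|M. ?L \<omega>) \<le> (LINT \<omega>:?reject (phi_star T \<epsilon>)|M. ?L \<omega>)"
    "(LINT \<omega>:?reject (phi_star T \<epsilon>)|M. ?L \<omega>) \<le> (LINT \<omega>:?reject \<phi>|M. ?L \<omega>) \<Longrightarrow>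
      AE \<omega> in M. ?L \<omega> = ?\<kappa> \<or> (\<omega> \<in> ?reject \<phi> \<longleftrightarrow> \<omega> \<in> ?reject (phi_star T \<epsilon>))"
    using neyman_pearson[where \<kappa> = ?\<kappa>, OF finite_measure_axioms integrable_likelihood[OF T, of a]
        test_outcome_event[OF star attack_signal_const, of 0 1]
        test_outcome_event[OF test attack_signal_const, of 0 1] exp_ge_zero] inside outside size
    by fast+
  from np(1) show "detection_failure M T w (\<lambda>_. a) (phi_star T \<epsilon>) \<le> detection_failure M T w (\<lambda>_. a) \<phi>"
    unfolding fail[OF star] fail[OF test] by linarith
  assume "detection_failure M T w (\<lambda>_. a) \<phi> \<le> detection_failure M T w (\<lambda>_. a) (phi_star T \<epsilon>)"
  then have "(LINT \<omega>:?reject (phi_star T \<epsilon>)|M. ?L \<omega>) \<le> (LINT \<omega>:?reject \<phi>|M. ?L \<omega>)"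
    unfolding fail[OF star] fail[OF test] by linarith
  then have "AE \<omega> in M. ?L \<omega> = ?\<kappa> \<or> (\<omega> \<in> ?reject \<phi> \<longleftrightarrow> \<omega> \<in> ?reject (phi_star T \<epsilon>))"
    by (rule np(2))
  with AE_terminal_value_neq[OF T, of ?k]
  have agree: "AE \<omega> in M. \<omega> \<in> ?reject \<phi> \<longleftrightarrow> \<omega> \<in> ?reject (phi_star T \<epsilon>)"
    by eventually_elim (simp only: L_le(3) simp_thms)
  \<comment> \<open>The set of paths on which the tests disagree: null for Brownian motion, hence
    null under drift \<open>a\<close>.\<close>
  let ?N = "({x \<in> space (path_space T). \<phi> x = 0} \<inter> {x \<in> space (path_space T). phi_star T \<epsilon> x = 1})
    \<union> ({x \<in> space (path_space T). \<phi> x = 1} \<inter> {x \<in> space (path_space T). phi_star T \<epsilon> x = 0})"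
  have "?N \<in> sets (path_space T)"
    by (intro sets.Un sets.Int is_test_sets star test)
  moreover have "AE \<omega> in M. trajectory T w (\<lambda>_. 0) \<omega> \<notin> ?N"
    using agree by (rule AE_mp) (auto intro!: AE_I2)
  ultimately have "AE \<omega> in M. trajectory T w (\<lambda>_. a) \<omega> \<notin> ?N"
    by (rule AE_trajectory_tilt[OF T])
  moreover have "x \<in> ?N \<or> phi_star T \<epsilon> x = \<phi> x" if "x \<in> space (path_space T)" for x
    using that test measurable_space[of \<phi> "path_space T" "count_space {0, 1}" x]
    by (auto simp: is_test_def phi_star_def)
  then have "trajectory T w (\<lambda>_. a) \<omega> \<notin> ?N \<longrightarrow>
      phi_star T \<epsilon> (trajectory T w (\<lambda>_. a) \<omega>) = \<phi> (trajectory T w (\<lambda>_. a) \<omega>)" if "\<omega> \<in> space M" for \<omega>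
    using measurable_space[OF measurable_trajectory_const that] by blast
  ultimately show "AE \<omega> in M. phi_star T \<epsilon> (trajectory T w (\<lambda>_. a) \<omega>) = \<phi> (trajectory T w (\<lambda>_. a) \<omega>)"
    by (rule AE_mp[OF _ AE_I2])
qed

text \<open>Perturbing the weight of the statistic \<open>x T\<close> in the direction of the deviation of the signal
  from its mean raises the mean of the statistic to first order and its standard deviation
  only to second order.\<close>

lemma better_test_if_not_const:
  assumes t: "0 < t" "t < T" and \<epsilon>: "0 < \<epsilon>" "\<epsilon> < 1" and m: "0 < (LBINT s:{0..T}. \<theta> s)"
    and deviates: "T * (LBINT s:{0..t}. \<theta> s) \<noteq> t * (LBINT s:{0..T}. \<theta> s)"
  shows "\<exists>\<phi>\<in>tests M T w \<epsilon>. detection_failure M T w \<theta> \<phi> < detection_failure M T w \<theta> (phi_star T \<epsilon>)"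
proof -
  define m where "m = (LBINT s:{0..T}. \<theta> s)"
  define F where "F = (LBINT s:{0..t}. \<theta> s)"
  define D where "D = F - t / T * m"
  \<comment> \<open>\<open>\<eta>\<close> has the sign of \<open>D\<close>, so
    \<open>\<eta> * D\<close> is positive. Dividing by \<open>m + \<bar>D\<bar>\<close> keeps its
    modulus below 1, so that \<open>p\<close> and \<open>q\<close> are positive, and yields
    \<open>m * \<eta>\<^sup>2 \<le> \<eta> * D\<close>.\<close>
  define \<eta> where "\<eta> = D / (m + \<bar>D\<bar>)"
  \<comment> \<open>The weights are 1 + \<eta> h for the step function h with value
    \<open>1 - t / T\<close> up to \<open>t\<close> and \<open>- (t / T)\<close> afterwards. Its
    integral is 0, its inner product with the signal is \<open>D\<close>, and its squared norm is
    \<open>V\<close>.\<close>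
  define p where "p = 1 + \<eta> * (1 - t / T)"
  define q where "q = 1 - \<eta> * (t / T)"
  define V where "V = t * (T - t) / T"
  define \<sigma> where "\<sigma> = sqrt (p\<^sup>2 * t + q\<^sup>2 * (T - t))"
  let ?\<mu> = "p * F + q * (m - F)"
  have T: "0 < T" using t by simp
  have m: "0 < m" using m by (simp add: m_def)
  have D: "D \<noteq> 0"
    using deviates T by (auto simp: D_def F_def m_def field_simps)
  have \<eta>: "\<bar>\<eta>\<bar> < 1"
    using m by (simp add: \<eta>_def)
  have r: "0 < t / T" "t / T < 1"
    using t by auto
  have "\<bar>\<eta> * s\<bar> < 1" if "0 < s" "s < 1" for s
    using mult_strict_mono[of "\<bar>\<eta>\<bar>" 1 s 1] \<eta> that by (simp add: abs_mult)
  from this[of "1 - t / T"] this[of "t / T"] r have "\<bar>\<eta> * (1 - t / T)\<bar> < 1" "\<bar>\<eta> * (t / T)\<bar> < 1"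
    by simp_all
  then have pq: "0 < p" "0 < q"
    unfolding p_def q_def by linarith+
  have \<mu>: "?\<mu> = m + \<eta> * D"
    using T by (simp add: p_def q_def D_def field_simps)
  have \<sigma>2: "p\<^sup>2 * t + q\<^sup>2 * (T - t) = T + \<eta>\<^sup>2 * V"
    using T by (simp add: p_def q_def V_def field_simps power2_eq_square)
  have V: "0 < V" "V < T"
    using t T mult_strict_mono[of t T "T - t" T] by (auto simp: V_def divide_less_eq)
  have \<eta>D: "0 < \<eta> * D"
  proof -
    have "0 < D\<^sup>2 / (m + \<bar>D\<bar>)"
      using D m by (intro divide_pos_pos add_pos_nonneg) auto
    then show ?thesis
      by (simp add: \<eta>_def power2_eq_square)
  qed
  have mV: "m * \<eta>\<^sup>2 \<le> \<eta> * D"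
  proof -
    have "m * \<eta> * \<eta> = (m / (m + \<bar>D\<bar>)) * (\<eta> * D)"
      by (simp add: \<eta>_def)
    also have "\<dots> \<le> 1 * (\<eta> * D)"
      using m \<eta>D by (intro mult_right_mono) auto
    finally show ?thesis
      by (simp add: power2_eq_square mult_ac)
  qed
  \<comment> \<open>The squared form of the comparison of mean over standard deviation. The added
    variance costs at most \<open>m * (\<eta> * D) * V\<close>, while the added mean gains at least
    \<open>2 * m * (\<eta> * D) * T\<close>, which is more since \<open>V < T\<close>.\<close>
  have "m\<^sup>2 * (T + \<eta>\<^sup>2 * V) < (m + \<eta> * D)\<^sup>2 * T"
  proof -
    have "m\<^sup>2 * (\<eta>\<^sup>2 * V) = m * (m * \<eta>\<^sup>2) * V"
      by (simp add: power2_eq_square)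
    also have "\<dots> \<le> m * (\<eta> * D) * V"
      using m V mV by (intro mult_right_mono mult_left_mono) auto
    also have "\<dots> < m * (\<eta> * D) * (2 * T)"
      using m \<eta>D V T by (intro mult_strict_left_mono) auto
    also have "\<dots> \<le> (2 * m * (\<eta> * D) + (\<eta> * D)\<^sup>2) * T"
      using T by (simp add: algebra_simps)
    finally show ?thesis
      by (simp add: algebra_simps power2_eq_square)
  qed
  then have "sqrt (m\<^sup>2 * (T + \<eta>\<^sup>2 * V)) < sqrt ((m + \<eta> * D)\<^sup>2 * T)"
    by simp
  then have "m * \<sigma> < ?\<mu> * sqrt T"
    using m \<eta>D by (simp add: real_sqrt_mult \<mu> \<sigma>_def \<sigma>2)
  moreover have \<sigma>: "0 < \<sigma>"
    using T V \<sigma>2 by (auto simp: \<sigma>_def intro!: add_pos_nonneg)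
  ultimately have gain: "m / sqrt T < ?\<mu> / \<sigma>"
    using T by (simp add: divide_less_eq pos_less_divide_eq field_simps)
  let ?\<phi> = "linear_test T t p q (\<sigma> * Phi_inv (1 - \<epsilon>))"
  have "detection_failure M T w \<theta> ?\<phi> = Phi (Phi_inv (1 - \<epsilon>) - ?\<mu> / \<sigma>)"
    using detection_failure_linear_test[OF t, of p q \<theta> "\<sigma> * Phi_inv (1 - \<epsilon>)"] pq \<sigma>
    by (simp add: \<sigma>_def[symmetric] m_def[symmetric] F_def[symmetric] diff_divide_distrib)
  then have "detection_failure M T w \<theta> ?\<phi> < detection_failure M T w \<theta> (phi_star T \<epsilon>)"
    using gain by (simp add: detection_failure_phi_star[OF T] m_def[symmetric])
  moreover have "?\<phi> \<in> tests M T w \<epsilon>"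
    using is_test_linear_test[of t T] false_alarm_linear_test[OF t, of p q \<epsilon>] t pq \<epsilon>
    by (simp add: tests_def \<sigma>_def)
  ultimately show ?thesis
    by blast
qed

end

section \<open>The saddle point, its uniqueness and the value of the game\<close>

theorem theorem1:
  fixes M :: "'a measure" and w :: "real \<Rightarrow> 'a \<Rightarrow> real" and T d c \<epsilon> :: real
  assumes T: "T > 0" and d: "d > 0" and c: "c \<in> {1/2<..<1}" and \<epsilon>: "\<epsilon> \<in> {0<..<1/2}"
    and w: "std_brownian_motion M T w"
  shows "saddle_point M T w d c \<epsilon> (theta_star T d c) (phi_star T \<epsilon>) \<and>
         (\<forall>\<theta>' \<phi>'. saddle_point M T w d c \<epsilon> \<theta>' \<phi>' \<longrightarrow>
            (AE t in lborel. t \<in> {0..T} \<longrightarrow> theta_star T d c t = \<theta>' t) \<and>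
            (AE \<omega> in M. phi_star T \<epsilon> (trajectory T w (theta_star T d c) \<omega>) =
                        \<phi>' (trajectory T w (theta_star T d c) \<omega>))) \<and>
         minimax_value M T w d c \<epsilon> = detection_failure M T w (theta_star T d c) (phi_star T \<epsilon>) \<and>
         maximin_value M T w d c \<epsilon> = detection_failure M T w (theta_star T d c) (phi_star T \<epsilon>) \<and>
         detection_failure M T w (theta_star T d c) (phi_star T \<epsilon>) =
           Phi (Phi_inv (1 - \<epsilon>) - Phi_inv c - sqrt T * d) \<and>
         (1 - \<epsilon> = c \<longrightarrow>
           detection_failure M T w (theta_star T d c) (phi_star T \<epsilon>) = Phi (- sqrt T * d))"
proof -
  interpret std_brownian_motion M T w by (rule w)
  let ?\<beta> = "detection_failure M T w"
  let ?\<theta> = "theta_star T d c" and ?\<phi> = "phi_star T \<epsilon>"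
  define a where "a = 1 / sqrt T * Phi_inv c + d"
  have \<theta>: "?\<theta> = (\<lambda>_. a)"
    by (simp add: theta_star_def a_def)
  have \<epsilon>': "0 < \<epsilon>" "\<epsilon> < 1"
    using \<epsilon> by auto
  have "Phi 0 < Phi (Phi_inv c)"
    using c by (simp add: Phi_zero Phi_Phi_inv)
  then have a: "0 < a"
    using T d by (simp add: a_def add_pos_pos)
  have attack_iff: "\<theta> \<in> attacks T d c \<longleftrightarrow> attack_signal T \<theta> \<and> T * a \<le> (LBINT t:{0..T}. \<theta> t)" for \<theta>
    using mem_attacks_iff[OF T] c by (simp add: a_def)
  have int_star: "(LBINT t:{0..T}. ?\<theta> t) = T * a"
    using T by (simp add: \<theta> set_integral_const_Icc)
  have star_attack: "?\<theta> \<in> attacks T d c"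
    unfolding attack_iff int_star by (simp add: \<theta> attack_signal_const)
  have star_test: "?\<phi> \<in> tests M T w \<epsilon>"
    using is_test_phi_star[OF T] false_alarm_phi_star[OF T \<epsilon>'] by (simp add: tests_def)
  \<comment> \<open>Against \<open>?\<phi>\<close> a larger integral of the signal only helps
    detection, and \<open>?\<theta>\<close> has the smallest admissible one.\<close>
  have attacker: "?\<beta> \<theta> ?\<phi> \<le> ?\<beta> ?\<theta> ?\<phi>" if "\<theta> \<in> attacks T d c" for \<theta>
    using that T unfolding attack_iff
    by (simp add: detection_failure_phi_star[OF T] int_star divide_right_mono)
  have detector: "?\<beta> ?\<theta> ?\<phi> \<le> ?\<beta> ?\<theta> \<phi>" if "\<phi> \<in> tests M T w \<epsilon>" for \<phi>
    using phi_star_most_powerful(1)[OF T a \<epsilon>' that] by (simp add: \<theta>)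
  have saddle: "saddle_point M T w d c \<epsilon> ?\<theta> ?\<phi>"
    using star_attack star_test attacker detector by (auto simp: saddle_point_def)
  have unique: "(AE t in lborel. t \<in> {0..T} \<longrightarrow> ?\<theta> t = \<theta>' t) \<and>
      (AE \<omega> in M. ?\<phi> (trajectory T w ?\<theta> \<omega>) = \<phi>' (trajectory T w ?\<theta> \<omega>))"
    if s: "saddle_point M T w d c \<epsilon> \<theta>' \<phi>'" for \<theta>' \<phi>'
  proof
    have mem: "\<theta>' \<in> attacks T d c" "\<phi>' \<in> tests M T w \<epsilon>"
      and attacker': "\<And>\<theta>. \<theta> \<in> attacks T d c \<Longrightarrow> ?\<beta> \<theta> \<phi>' \<le> ?\<beta> \<theta>' \<phi>'"
      and detector': "\<And>\<phi>. \<phi> \<in> tests M T w \<epsilon> \<Longrightarrow> ?\<beta> \<theta>' \<phi>' \<le> ?\<beta> \<theta>' \<phi>"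
      using s by (auto simp: saddle_point_def)
    \<comment> \<open>These inequalities form a closed cycle through the four pairings of old and
      new strategies, so all four failure probabilities are equal.\<close>
    note chain = attacker'[OF star_attack] detector'[OF star_test] attacker[OF mem(1)] detector[OF mem(2)]
    have "?\<beta> ?\<theta> \<phi>' \<le> ?\<beta> ?\<theta> ?\<phi>"
      using chain by linarith
    then show "AE \<omega> in M. ?\<phi> (trajectory T w ?\<theta> \<omega>) = \<phi>' (trajectory T w ?\<theta> \<omega>)"
      using phi_star_most_powerful(2)[OF T a \<epsilon>' mem(2)] by (simp add: \<theta>)
    have "?\<beta> \<theta>' ?\<phi> = ?\<beta> ?\<theta> ?\<phi>"
      using chain by linarith
    \<comment> \<open>Against \<open>?\<phi>\<close> the failure probability is an injective
      function of the integral of the signal.\<close>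
    then have m: "(LBINT t:{0..T}. \<theta>' t) = T * a"
      using T by (simp add: detection_failure_phi_star[OF T] int_star)
    \<comment> \<open>The cycle transfers optimality against \<open>\<theta>'\<close> from
      \<open>\<phi>'\<close> to \<open>?\<phi>\<close>. A nonlinear indefinite integral of
      \<open>\<theta>'\<close> would then contradict
      \<open>better_test_if_not_const\<close>.\<close>
    have optimal: "?\<beta> \<theta>' ?\<phi> \<le> ?\<beta> \<theta>' \<phi>" if "\<phi> \<in> tests M T w \<epsilon>" for \<phi>
      using chain detector'[OF that] by linarith
    have "(LBINT s:{0..t}. \<theta>' s) = t * a" if "t \<in> {0..T}" for t
    proof -
      consider "t = 0" | "0 < t" "t < T" | "t = T"
        using \<open>t \<in> {0..T}\<close> by force
      then show ?thesis
      proof cases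
        case 1
        have "AE s in lborel. indicator {0..0} s *\<^sub>R \<theta>' s = 0"
          using AE_lborel_singleton[of 0] by (rule AE_mp) auto
        then have "(LBINT s. indicator {0..0} s *\<^sub>R \<theta>' s) = 0"
          by (rule integral_eq_zero_AE)
        then show ?thesis
          using 1 by (simp add: set_lebesgue_integral_def)
      next
        case 2
        then have "T * (LBINT s:{0..t}. \<theta>' s) = t * (LBINT s:{0..T}. \<theta>' s)"
          using better_test_if_not_const[OF 2 \<epsilon>', of \<theta>'] optimal T a m by (force simp: not_less)
        then show ?thesis
          using T by (simp add: m)
      next
        case 3
        then show ?thesis
          using m by simp
      qed
    qed
    then have "AE t in lborel. t \<in> {0..T} \<longrightarrow> \<theta>' t = a"
      using mem(1) by (intro AE_const_if_indefinite_integral_linear) (auto simp: attack_iff attack_signal_def)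
    then show "AE t in lborel. t \<in> {0..T} \<longrightarrow> ?\<theta> t = \<theta>' t"
      by (rule AE_mp) (auto simp: \<theta>)
  qed
  have range: "0 \<le> ?\<beta> \<theta> \<phi>" "?\<beta> \<theta> \<phi> \<le> 1" for \<theta> \<phi>
    by (auto simp: detection_failure_def)
  \<comment> \<open>Real infima and suprema obey the usual bounds only on bounded families; here all
    values are probabilities.\<close>
  have bdd: "bdd_above ((\<lambda>\<theta>. g \<theta>) ` X)" "bdd_below ((\<lambda>\<theta>. g \<theta>) ` X)"
    if "\<And>x. x \<in> X \<Longrightarrow> 0 \<le> g x \<and> g x \<le> (1::real)" for g and X :: "'b set"
    using that by (auto intro!: bdd_aboveI2[of _ _ 1] bdd_belowI2[of _ 0])
  have sup: "0 \<le> (SUP \<theta>\<in>attacks T d c. ?\<beta> \<theta> \<phi>)" for \<phi>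
    by (rule cSUP_upper2[OF bdd(1) star_attack]) (auto simp: range)
  have inf: "(INF \<phi>\<in>tests M T w \<epsilon>. ?\<beta> \<theta> \<phi>) \<le> 1" for \<theta>
    by (rule cINF_lower2[OF bdd(2) star_test]) (auto simp: range)
  \<comment> \<open>The test \<open>?\<phi>\<close> bounds the infimum from above, and the signal
    \<open>?\<theta>\<close> bounds every inner supremum from below.\<close>
  have "minimax_value M T w d c \<epsilon> = ?\<beta> ?\<theta> ?\<phi>"
    unfolding minimax_value_def
  proof (rule antisym)
    have "(INF \<phi>\<in>tests M T w \<epsilon>. SUP \<theta>\<in>attacks T d c. ?\<beta> \<theta> \<phi>) \<le> (SUP \<theta>\<in>attacks T d c. ?\<beta> \<theta> ?\<phi>)"
      by (rule cINF_lower[OF bdd_belowI2[of _ 0] star_test]) (rule sup)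
    also have "\<dots> \<le> ?\<beta> ?\<theta> ?\<phi>"
      using star_attack attacker by (intro cSUP_least) auto
    finally show "(INF \<phi>\<in>tests M T w \<epsilon>. SUP \<theta>\<in>attacks T d c. ?\<beta> \<theta> \<phi>) \<le> ?\<beta> ?\<theta> ?\<phi>" .
    show "?\<beta> ?\<theta> ?\<phi> \<le> (INF \<phi>\<in>tests M T w \<epsilon>. SUP \<theta>\<in>attacks T d c. ?\<beta> \<theta> \<phi>)"
    proof (rule cINF_greatest)
      fix \<phi> assume "\<phi> \<in> tests M T w \<epsilon>"
      then show "?\<beta> ?\<theta> ?\<phi> \<le> (SUP \<theta>\<in>attacks T d c. ?\<beta> \<theta> \<phi>)"
        by (intro cSUP_upper2[OF bdd(1) star_attack] detector) (auto simp: range)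
    qed (use star_test in auto)
  qed
  \<comment> \<open>Dually, \<open>?\<theta>\<close> bounds the supremum from below, and
    \<open>?\<phi>\<close> bounds every inner infimum from above.\<close>
  moreover have "maximin_value M T w d c \<epsilon> = ?\<beta> ?\<theta> ?\<phi>"
    unfolding maximin_value_def
  proof (rule antisym)
    have "?\<beta> ?\<theta> ?\<phi> \<le> (INF \<phi>\<in>tests M T w \<epsilon>. ?\<beta> ?\<theta> \<phi>)"
      using star_test detector by (intro cINF_greatest) auto
    also have "\<dots> \<le> (SUP \<theta>\<in>attacks T d c. INF \<phi>\<in>tests M T w \<epsilon>. ?\<beta> \<theta> \<phi>)"
      by (rule cSUP_upper[OF star_attack bdd_aboveI2[of _ _ 1]]) (rule inf)
    finally show "?\<beta> ?\<theta> ?\<phi> \<le> (SUP \<theta>\<in>attacks T d c. INF \<phi>\<in>tests M T w \<epsilon>. ?\<beta> \<theta> \<phi>)" .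
    show "(SUP \<theta>\<in>attacks T d c. INF \<phi>\<in>tests M T w \<epsilon>. ?\<beta> \<theta> \<phi>) \<le> ?\<beta> ?\<theta> ?\<phi>"
    proof (rule cSUP_least)
      fix \<theta> assume "\<theta> \<in> attacks T d c"
      then show "(INF \<phi>\<in>tests M T w \<epsilon>. ?\<beta> \<theta> \<phi>) \<le> ?\<beta> ?\<theta> ?\<phi>"
        by (intro cINF_lower2[OF bdd(2) star_test] attacker) (auto simp: range)
    qed (use star_attack in auto)
  qed
  moreover have "T * a / sqrt T = Phi_inv c + sqrt T * d"
  proof -
    have "T / sqrt T = sqrt T"
      using T by (simp add: real_div_sqrt)
    then have "T * a / sqrt T = sqrt T * a"
      by (metis times_divide_eq_left)
    then show ?thesis
      using T by (simp add: a_def algebra_simps)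
  qed
  then have "?\<beta> ?\<theta> ?\<phi> = Phi (Phi_inv (1 - \<epsilon>) - Phi_inv c - sqrt T * d)"
    by (simp add: detection_failure_phi_star[OF T] int_star algebra_simps)
  ultimately show ?thesis
    using saddle unique by auto
qed

end
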